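(* Let $S$ be the antipode of the Hopf algebra $(\mathbb{K}[\mathcal{NCP}],\cdot,\Delta)$ and, for $n\ge1$, let $J_n=\{\{1\},\ldots,\{n\}\}$. For any $n\ge1$, $$S(J_n)=\sum_{\pi\text{ noncrossing partition of }[n]}\mu_{\mathcal{NCP}}(\pi)\prod_{b\in\pi}J_{|b|}$$ $$=\sum_{(k_1,\ldots,k_n)\in\mathrm{Part}(n)}(-1)^{k_1+\cdots+k_n}\left(\sum_{\substack{\pi\text{ noncrossing partition of }[n],\\ p(\pi)=(k_1,\ldots,k_n)}}\ \prod_{C\in\pi/\sim_\pi}\mathrm{cat}_{|C|}\right)J_1^{k_1}\cdot\ldots\cdot J_n^{k_n},$$ all products and powers of the $J_i$ being taken in $\mathbb{K}[\mathcal{NCP}]$. In particular, the coefficient of $J_1^{n}$ in $S(J_n)$ is $(-1)^n\mathrm{cat}_n$.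
   Context: $\mathbb{K}$ is a field of characteristic zero. $\mathrm{cat}_n=\frac{1}{n+1}\binom{2n}{n}$. $\mathrm{Part}(n)=\{(k_1,\ldots,k_n)\in\mathbb{N}^n\mid 1k_1+\cdots+nk_n=n\}$. A noncrossing partition is a partition $\pi$ of a set $[n]=\{1,\ldots,n\}$, $n\ge1$, into nonempty blocks such that there are no distinct blocks $b\ne b'$ and $x,z\in b$, $y,t\in b'$ with $x<y<z<t$. $|\pi|$ is its number of blocks; $\mathcal{NCP}$ is the set of all noncrossing partitions. For $\pi$ a noncrossing partition of $[n]$, $p(\pi)=(p_1(\pi),\ldots,p_n(\pi))$ with $p_i(\pi)$ the number of blocks of $\pi$ of cardinality $i$. The equivalence $\sim_\pi$ on the set of blocks of $\pi$: $b\sim_\pi b'$ if there is a sequence $(b_1,\ldots,b_k)$ of blocks of $\pi$ with $b_1=b,b_k=b'$ or $b_1=b',b_k=b$, and $\max(b_i)+1=\min(b_{i+1})$ for all $1\le i\le k-1$; $|C|$ is the number of blocks in a class $C$. For a nonempty set $Y$ of blocks of $\pi$, $\pi_{\mid Y}$ is the noncrossing partition obtained by deleting the blocks not in $Y$ and renumbering the remaining elements increasingly; $\pi_{\mid\emptyset}=1$. The nesting order on blocks is $b\le_\pi b'\iff b'\subseteq[\min b,\max b]$. An ideal of $\pi$ is a set $J$ of blocks that is upward closed for $\le_\pi$; then the union of its blocks decomposes into maximal subsets of consecutive integers $I_1,\ldots,I_k$, each a union of blocks, and $\pi_{\mid_\cdot J}=\prod_i\pi_{\mid I_i}$ (restriction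 to the blocks contained in $I_i$; product $\cdot$ below). $\mathbb{K}[\mathcal{NCP}]$ is the free commutative algebra generated by $\mathcal{NCP}$, with product $\cdot$ and unit $1$. It carries two coproducts which are algebra morphisms, given on $\pi\in\mathcal{NCP}$ by $\Delta(\pi)=\sum_{J\text{ ideal of }\pi}\pi_{\mid\pi\setminus J}\otimes\pi_{\mid_\cdot J}$ and $\delta(\pi)=\sum_{\sim\in\mathcal{E}_c[\pi]}\pi/\!\sim\,\otimes\,\pi\mid_\cdot\sim$, where, for an equivalence $\sim$ on the set of blocks of $\pi$, $\pi/\!\sim$ is the partition whose blocks are the unions of the blocks in each class, $\mathcal{E}_c[\pi]$ is the set of $\sim$ for which $\pi/\!\sim$ is noncrossing, and $\pi\mid_\cdot\sim=\prod_{C\text{ class of }\sim}\pi_{\mid C}$. The counits are the algebra morphisms with $\varepsilon_\Delta(\pi)=0$, and $\epsilon_\delta(\pi)=1$ if $|\pi|=1$, $\epsilon_\delta(\pi)=0$ otherwise. $(\mathbb{K}[\mathcal{NCP}],\cdot,\Delta)$ is a connected graded Hopf algebra (graded by the number of blocks). $\mathbb{K}[X]$ has the multiplicative coproducts $\Delta(X)=X\otimes1+1\otimes X$, $\delta(X)=X\otimes X$ with counits $P\mapsto P(0)$, $P\mapsto P(1)$. $\phi_{\mathcal{NCP}}:\mathbb{K}[\mathcal{NCP}]\to\mathbb{K}[X]$ is the unique algebra morphism compatible with both coproducts $\Delta,\delta$ and both counits (it exists and is unique by known results). The character $\mu_{\mathcal{NCP}}:\mathbb{K}[\mathcal{NCP}]\to\mathbb{K}$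 is $\mu_{\mathcal{NCP}}(x)=\phi_{\mathcal{NCP}}(x)(-1)$; by known results on double bialgebras it is the inverse of $\epsilon_\delta$ for the convolution $\lambda*\lambda'=(\lambda\otimes\lambda')\circ\Delta$, and $S=(\mu_{\mathcal{NCP}}\otimes\mathrm{Id})\circ\delta$. *)

theory Defs
  imports Complex_Main "HOL-Library.Poly_Mapping" "HOL-Library.Multiset"
    "HOL-Library.Product_Plus" "HOL-Library.Disjoint_Sets" "HOL-Library.FuncSet"
    "HOL-Computational_Algebra.Polynomial"
begin

section \<open>Noncrossing partitions\<close>

definition noncrossing :: "nat set set \<Rightarrow> bool" where
  "noncrossing P \<longleftrightarrow> (\<forall>b\<in>P. \<forall>b'\<in>P. b \<noteq> b' \<longrightarrow>
     \<not> (\<exists>x\<in>b. \<exists>z\<in>b. \<exists>y\<in>b'. \<exists>t\<in>b'. x < y \<and> y < z \<and> z < t))"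

definition is_ncp :: "nat set set \<Rightarrow> bool" where
  "is_ncp P \<longleftrightarrow> (\<exists>n\<ge>1. partition_on {1..n} P) \<and> noncrossing P"

lemma is_ncp_singletons:
  assumes "n \<ge> 1"
  shows "is_ncp ((\<lambda>i. {i}) ` {1..n})"
proof -
  have "partition_on {1..n} ((\<lambda>i. {i}) ` {1..n})"
    by (auto simp: partition_on_def disjoint_def)
  moreover have "noncrossing ((\<lambda>i. {i}) ` {1..n})"
    by (auto simp: noncrossing_def)
  ultimately show ?thesis
    using assms by (auto simp: is_ncp_def)
qed

typedef ncp = "{P. is_ncp P}"
  morphisms blocks Abs_ncp
  using is_ncp_singletons[of 1] by blast

definition NCP :: "nat \<Rightarrow> ncp set" where
  "NCP n = {\<pi>. partition_on {1..n} (blocks \<pi>)}"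

definition discrete_ncp :: "nat \<Rightarrow> ncp" where
  "discrete_ncp n = Abs_ncp ((\<lambda>i. {i}) ` {1..n})"

text \<open>The vector \<open>p(\<pi>)\<close>, for \<open>\<pi>\<close> a noncrossing partition of \<open>{1..n}\<close>. An \<open>n\<close>-tuple
  \<open>(k_1, ..., k_n)\<close> is an extensional function on \<open>{1..n}\<close>.\<close>

definition block_sizes :: "nat \<Rightarrow> ncp \<Rightarrow> nat \<Rightarrow> nat" where
  "block_sizes n \<pi> = restrict (\<lambda>i. card {b \<in> blocks \<pi>. card b = i}) {1..n}"

definition Part :: "nat \<Rightarrow> (nat \<Rightarrow> nat) set" where
  "Part n = {k \<in> {1..n} \<rightarrow>\<^sub>E UNIV. (\<Sum>i=1..n. i * k i) = n}"

definition adjacent :: "ncp \<Rightarrow> (nat set \<times> nat set) set" where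
  "adjacent \<pi> = {(b, b') \<in> blocks \<pi> \<times> blocks \<pi>. Max b + 1 = Min b'}"

definition sim :: "ncp \<Rightarrow> (nat set \<times> nat set) set" where
  "sim \<pi> = {(b, b') \<in> blocks \<pi> \<times> blocks \<pi>. (b, b') \<in> (adjacent \<pi>)\<^sup>* \<or> (b', b) \<in> (adjacent \<pi>)\<^sup>*}"

definition cat :: "nat \<Rightarrow> 'k::field_char_0" where
  "cat n = 1 / of_nat (n + 1) * of_nat ((2 * n) choose n)"

text \<open>Renumbering the elements of a family of finite sets increasingly by \<open>1, 2, ...\<close>\<close>

definition standardize :: "nat set set \<Rightarrow> nat set set" where
  "standardize Y = (\<lambda>b. (\<lambda>x. card {y \<in> \<Union>Y. y \<le> x}) ` b) ` Y"

lemma is_ncp_standardize: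
  assumes P: "is_ncp P" and Y: "Y \<subseteq> P" "Y \<noteq> {}"
  shows "is_ncp (standardize Y)"
proof -
  define U where "U = \<Union>Y"
  define r where "r = (\<lambda>x. card {y \<in> U. y \<le> x})"
  have std: "standardize Y = (`) r ` Y"
    by (simp add: standardize_def r_def U_def)
  obtain n where n: "partition_on {1..n} P" and nc: "noncrossing P"
    using P by (auto simp: is_ncp_def)
  have "U \<subseteq> {1..n}"
    using Y(1) partition_onD1[OF n] by (auto simp: U_def)
  then have fin: "finite U"
    by (rule finite_subset) simp
  obtain b0 where "b0 \<in> Y"
    using Y(2) by blast
  then have "b0 \<noteq> {}" "b0 \<subseteq> U"
    using Y(1) partition_onD3[OF n] by (auto simp: U_def)
  then have ne: "U \<noteq> {}"
    by blast
  have part: "partition_on U Y"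
    unfolding partition_on_def U_def
    using pairwise_subset[OF partition_onD2[OF n] Y(1)] partition_onD3[OF n] Y(1) by auto
  have less: "r x < r y" if "x \<in> U" "y \<in> U" "x < y" for x y
  proof -
    have "{w \<in> U. w \<le> x} \<subseteq> {w \<in> U. w \<le> y}" "y \<in> {w \<in> U. w \<le> y}" "y \<notin> {w \<in> U. w \<le> x}"
      using that by auto
    then have "{w \<in> U. w \<le> x} \<subset> {w \<in> U. w \<le> y}"
      by blast
    then show ?thesis
      unfolding r_def using fin by (intro psubset_card_mono) auto
  qed
  have iff: "r x < r y \<longleftrightarrow> x < y" if "x \<in> U" "y \<in> U" for x y
    using less[of x y] less[of y x] that by (cases x y rule: linorder_cases) auto
  have inj: "inj_on r U"
  proof (rule inj_onI)
    fix x y assume "x \<in> U" "y \<in> U" "r x = r y"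
    then show "x = y"
      using less[of x y] less[of y x] by (cases x y rule: linorder_cases) auto
  qed
  have "r ` U \<subseteq> {1..card U}"
    using fin by (auto simp: r_def Suc_le_eq card_gt_0_iff intro!: card_mono)
  then have img: "r ` U = {1..card U}"
    by (intro card_subset_eq) (auto simp: card_image[OF inj])
  have "partition_on (r ` U) ((`) r ` Y - {{}})"
    using part inj by (rule partition_on_inj_image)
  moreover have "{} \<notin> (`) r ` Y"
    using partition_onD3[OF part] by auto
  ultimately have "partition_on {1..card U} (standardize Y)"
    using img std by simp
  moreover have "noncrossing (standardize Y)"
    unfolding noncrossing_def std
  proof (intro ballI impI notI)
    fix c c'
    assume c: "c \<in> (`) r ` Y" "c' \<in> (`) r ` Y" "c \<noteq> c'"
      and *: "\<exists>x\<in>c. \<exists>z\<in>c. \<exists>y\<in>c'. \<exists>t\<in>c'. x < y \<and> y < z \<and> z < t"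
    obtain b b' where b: "b \<in> Y" "b' \<in> Y" "c = r ` b" "c' = r ` b'"
      using c by auto
    obtain x z y t where x: "x \<in> b" "z \<in> b" "y \<in> b'" "t \<in> b'" "r x < r y" "r y < r z" "r z < r t"
      using * b by auto
    have "x \<in> U" "z \<in> U" "y \<in> U" "t \<in> U"
      using x b by (auto simp: U_def)
    then have "x < y" "y < z" "z < t"
      using x(5-7) iff[of x y] iff[of y z] iff[of z t] by blast+
    have "b \<noteq> b'"
      using b(3,4) c(3) by metis
    moreover have "b \<in> P" "b' \<in> P"
      using b(1,2) Y(1) by (metis subsetD)+
    ultimately have "\<not> (\<exists>x\<in>b. \<exists>z\<in>b. \<exists>y\<in>b'. \<exists>t\<in>b'. x < y \<and> y < z \<and> z < t)"
      by (intro nc[unfolded noncrossing_def, rule_format])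
    moreover have "\<exists>x\<in>b. \<exists>z\<in>b. \<exists>y\<in>b'. \<exists>t\<in>b'. x < y \<and> y < z \<and> z < t"
      by (rule bexI[OF _ x(1)], rule bexI[OF _ x(2)], rule bexI[OF _ x(3)], rule bexI[OF _ x(4)])
        (intro conjI \<open>x < y\<close> \<open>y < z\<close> \<open>z < t\<close>)
    ultimately show False
      by contradiction
  qed
  moreover have "card U \<ge> 1"
    using fin ne by (simp add: Suc_le_eq card_gt_0_iff)
  ultimately show ?thesis
    unfolding is_ncp_def by (intro conjI exI[of _ "card U"])
qed

definition is_ideal :: "ncp \<Rightarrow> nat set set \<Rightarrow> bool" where
  "is_ideal \<pi> J \<longleftrightarrow> J \<subseteq> blocks \<pi> \<and>
     (\<forall>b\<in>J. \<forall>b'\<in>blocks \<pi>. b' \<subseteq> {Min b..Max b} \<longrightarrow> b' \<in> J)"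

definition is_interval_nat :: "nat set \<Rightarrow> bool" where
  "is_interval_nat I \<longleftrightarrow> (\<exists>a b. a \<le> b \<and> I = {a..b})"

definition intervals_of :: "nat set \<Rightarrow> nat set set" where
  "intervals_of U = {I. is_interval_nat I \<and> I \<subseteq> U \<and>
     (\<forall>I'. is_interval_nat I' \<and> I \<subseteq> I' \<and> I' \<subseteq> U \<longrightarrow> I' = I)}"

definition quotient_ncp :: "(nat set \<times> nat set) set \<Rightarrow> ncp \<Rightarrow> nat set set" where
  "quotient_ncp r \<pi> = \<Union> ` (blocks \<pi> // r)"

definition Ec :: "ncp \<Rightarrow> (nat set \<times> nat set) set set" where
  "Ec \<pi> = {r. equiv (blocks \<pi>) r \<and> noncrossing (quotient_ncp r \<pi>)}"

lemma is_ncp_quotient_ncp: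
  assumes "r \<in> Ec \<pi>"
  shows "is_ncp (quotient_ncp r \<pi>)"
proof -
  define B where "B = blocks \<pi>"
  have r: "equiv B r" and nc: "noncrossing (quotient_ncp r \<pi>)"
    using assms unfolding Ec_def B_def mem_Collect_eq by (rule conjunct1, rule conjunct2)
  have "is_ncp B"
    using blocks[of \<pi>] by (simp add: B_def)
  then obtain n where n: "n \<ge> 1" "partition_on {1..n} B"
    by (auto simp: is_ncp_def)
  have "partition_on {1..n} (\<Union> ` (B // r))"
  proof (rule partition_onI)
    have "\<Union> (\<Union> ` (B // r)) = \<Union> (\<Union> (B // r))"
      by auto
    then show "\<Union> (\<Union> ` (B // r)) = {1..n}"
      using Union_quotient[OF r] partition_onD1[OF n(2)] by simp
  next
    fix p q
    assume "p \<in> \<Union> ` (B // r)" "q \<in> \<Union> ` (B // r)" "p \<noteq> q"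
    then obtain C D where CD: "C \<in> B // r" "D \<in> B // r" "p = \<Union>C" "q = \<Union>D"
      by auto
    with \<open>p \<noteq> q\<close> have "C \<inter> D = {}"
      using quotient_disj[OF r, of C D] by auto
    have "C \<subseteq> B" "D \<subseteq> B"
      using in_quotient_imp_subset[OF r] CD by auto
    show "disjnt p q"
      unfolding disjnt_iff
    proof (intro allI notI, elim conjE)
      fix u
      assume "u \<in> p" "u \<in> q"
      then obtain x y where xy: "x \<in> C" "y \<in> D" "u \<in> x" "u \<in> y"
        unfolding CD(3,4) by (elim UnionE)
      have "x \<noteq> y"
        using xy(1,2) \<open>C \<inter> D = {}\<close> by auto
      moreover have "x \<in> B" "y \<in> B"
        using xy(1,2) \<open>C \<subseteq> B\<close> \<open>D \<subseteq> B\<close> by auto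
      ultimately have "x \<inter> y = {}"
        using disjointD[OF partition_onD2[OF n(2)]] by simp
      then show False
        using xy(3,4) by auto
    qed
  next
    show "{} \<notin> \<Union> ` (B // r)"
    proof
      assume "{} \<in> \<Union> ` (B // r)"
      then obtain C where C: "C \<in> B // r" "\<Union>C = {}"
        by auto
      have "C \<noteq> {}" "C \<subseteq> B"
        using in_quotient_imp_non_empty[OF r C(1)] in_quotient_imp_subset[OF r C(1)] by auto
      then obtain b where "b \<in> C" "b \<in> B"
        by auto
      then show False
        using C partition_onD3[OF n(2)] by auto
    qed
  qed
  then show ?thesis
    using n(1) nc by (auto simp: is_ncp_def quotient_ncp_def B_def)
qed

section \<open>The algebra and its coproducts\<close>

text \<open>The free commutative algebra on \<open>ncp\<close> is the monoid algebra of the free commutative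
  monoid of finite multisets of noncrossing partitions (the monomials). Its tensor square has
  the pairs of monomials as a basis, and is the monoid algebra of the product monoid.\<close>

type_synonym 'k ncp_alg = "ncp multiset \<Rightarrow>\<^sub>0 'k"
type_synonym 'k ncp_tensor = "(ncp multiset \<times> ncp multiset) \<Rightarrow>\<^sub>0 'k"

abbreviation scalar :: "'k::comm_ring_1 \<Rightarrow> ('m::comm_monoid_add \<Rightarrow>\<^sub>0 'k)" where
  "scalar c \<equiv> Poly_Mapping.single 0 c"

definition scale_alg :: "'k::comm_ring_1 \<Rightarrow> ('m::comm_monoid_add \<Rightarrow>\<^sub>0 'k) \<Rightarrow> ('m \<Rightarrow>\<^sub>0 'k)" where
  "scale_alg c x = scalar c * x"

definition gen :: "ncp \<Rightarrow> 'k::comm_ring_1 ncp_alg" where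
  "gen \<pi> = Poly_Mapping.single {#\<pi>#} 1"

definition J :: "nat \<Rightarrow> 'k::comm_ring_1 ncp_alg" where
  "J n = gen (discrete_ncp n)"

definition tensor :: "'k::comm_ring_1 ncp_alg \<Rightarrow> 'k ncp_alg \<Rightarrow> 'k ncp_tensor" where
  "tensor x y = (\<Sum>m\<in>Poly_Mapping.keys x. \<Sum>m'\<in>Poly_Mapping.keys y.
     Poly_Mapping.single (m, m') (Poly_Mapping.lookup x m * Poly_Mapping.lookup y m'))"

text \<open>The algebra morphism into a commutative algebra with structure map \<open>\<iota>\<close> which extends
  \<open>f\<close>, and the linear map on the tensor square induced by a bilinear map \<open>B\<close>.\<close>

definition alg_extend :: "('k::comm_ring_1 \<Rightarrow> 'b::comm_ring_1) \<Rightarrow> (ncp \<Rightarrow> 'b) \<Rightarrow> 'k ncp_alg \<Rightarrow> 'b" where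
  "alg_extend \<iota> f x =
     (\<Sum>m\<in>Poly_Mapping.keys x. \<iota> (Poly_Mapping.lookup x m) * (\<Prod>\<pi>\<in>#m. f \<pi>))"

definition tensor_lift :: "('k::comm_ring_1 \<Rightarrow> 'b::comm_ring_1) \<Rightarrow>
    ('k ncp_alg \<Rightarrow> 'k ncp_alg \<Rightarrow> 'b) \<Rightarrow> 'k ncp_tensor \<Rightarrow> 'b" where
  "tensor_lift \<iota> B t = (\<Sum>(m, m')\<in>Poly_Mapping.keys t. \<iota> (Poly_Mapping.lookup t (m, m')) *
     B (Poly_Mapping.single m 1) (Poly_Mapping.single m' 1))"

text \<open>For a set \<open>Y\<close> of blocks of \<open>\<pi>\<close>, the element \<open>restriction Y\<close> is \<open>\<pi>\<close> restricted to \<open>Y\<close>,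
  and for an ideal \<open>Y\<close>, \<open>dot_restriction Y\<close> is the product over the maximal intervals.\<close>

definition restriction :: "nat set set \<Rightarrow> 'k::comm_ring_1 ncp_alg" where
  "restriction Y = (if Y = {} then 1 else gen (Abs_ncp (standardize Y)))"

definition dot_restriction :: "nat set set \<Rightarrow> 'k::comm_ring_1 ncp_alg" where
  "dot_restriction Y = (\<Prod>I\<in>intervals_of (\<Union>Y). restriction {b \<in> Y. b \<subseteq> I})"

definition Delta :: "'k::comm_ring_1 ncp_alg \<Rightarrow> 'k ncp_tensor" where
  "Delta = alg_extend scalar
     (\<lambda>\<pi>. \<Sum>Y | is_ideal \<pi> Y. tensor (restriction (blocks \<pi> - Y)) (dot_restriction Y))"

definition delta :: "'k::comm_ring_1 ncp_alg \<Rightarrow> 'k ncp_tensor" where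
  "delta = alg_extend scalar
     (\<lambda>\<pi>. \<Sum>r\<in>Ec \<pi>. tensor (gen (Abs_ncp (quotient_ncp r \<pi>)))
                            (\<Prod>C\<in>blocks \<pi> // r. restriction C))"

definition eps_Delta :: "'k::comm_ring_1 ncp_alg \<Rightarrow> 'k" where
  "eps_Delta = alg_extend (\<lambda>c. c) (\<lambda>\<pi>. 0)"

definition eps_delta :: "'k::comm_ring_1 ncp_alg \<Rightarrow> 'k" where
  "eps_delta = alg_extend (\<lambda>c. c) (\<lambda>\<pi>. if card (blocks \<pi>) = 1 then 1 else 0)"

text \<open>The convolution inverse of the identity for \<open>Delta\<close>.\<close>

definition is_antipode :: "('k::field_char_0 ncp_alg \<Rightarrow> 'k ncp_alg) \<Rightarrow> bool" where
  "is_antipode S \<longleftrightarrow> Vector_Spaces.linear scale_alg scale_alg S \<and>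
     (\<forall>x. tensor_lift scalar (\<lambda>u v. S u * v) (Delta x) = scalar (eps_Delta x)) \<and>
     (\<forall>x. tensor_lift scalar (\<lambda>u v. u * S v) (Delta x) = scalar (eps_Delta x))"

section \<open>The polynomial invariant\<close>

text \<open>The tensor square of \<open>K[X]\<close> is \<open>K[X][Y]\<close>: \<open>X \<otimes> 1\<close> is the inner and \<open>1 \<otimes> X\<close> the
  outer variable.\<close>

definition poly_tensor :: "'k::comm_ring_1 poly \<Rightarrow> 'k poly \<Rightarrow> 'k poly poly" where
  "poly_tensor p q = [:p:] * map_poly (\<lambda>c. [:c:]) q"

definition poly_Delta :: "'k::comm_ring_1 poly \<Rightarrow> 'k poly poly" where
  "poly_Delta p = poly (map_poly (\<lambda>c. [:[:c:]:]) p)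
     (poly_tensor [:0, 1:] 1 + poly_tensor 1 [:0, 1:])"

definition poly_delta :: "'k::comm_ring_1 poly \<Rightarrow> 'k poly poly" where
  "poly_delta p = poly (map_poly (\<lambda>c. [:[:c:]:]) p) (poly_tensor [:0, 1:] [:0, 1:])"

definition is_phi :: "('k::field_char_0 ncp_alg \<Rightarrow> 'k poly) \<Rightarrow> bool" where
  "is_phi \<phi> \<longleftrightarrow>
     Vector_Spaces.linear scale_alg smult \<phi> \<and> \<phi> 1 = 1 \<and> (\<forall>x y. \<phi> (x * y) = \<phi> x * \<phi> y) \<and>
     (\<forall>x. tensor_lift (\<lambda>c. [:[:c:]:]) (\<lambda>u v. poly_tensor (\<phi> u) (\<phi> v)) (Delta x)
          = poly_Delta (\<phi> x)) \<and>
     (\<forall>x. tensor_lift (\<lambda>c. [:[:c:]:]) (\<lambda>u v. poly_tensor (\<phi> u) (\<phi> v)) (delta x)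
          = poly_delta (\<phi> x)) \<and>
     (\<forall>x. poly (\<phi> x) 0 = eps_Delta x) \<and>
     (\<forall>x. poly (\<phi> x) 1 = eps_delta x)"

definition mu :: "('k::field_char_0 ncp_alg \<Rightarrow> 'k poly) \<Rightarrow> 'k ncp_alg \<Rightarrow> 'k" where
  "mu \<phi> x = poly (\<phi> x) (- 1)"

end

theory Submission
  imports Defs
begin

text \<open>
  The map \<open>\<phi>\<close> intertwines the coproducts \<open>Delta\<close>, so evaluating the identity
  \<open>\<Delta>(\<phi>(x)) = (\<phi> \<otimes> \<phi>)(\<Delta>(x))\<close> at a pair of scalars \<open>a, b\<close> shows that the
  characters \<open>x \<mapsto> \<phi>(x)(a)\<close> multiply under convolution like the additive group of the field
  (\<open>phi_convolution\<close>). At \<open>1\<close> and \<open>-1\<close> this says that \<open>mu\<close> is both a left and a right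
  inverse of \<open>eps_delta\<close> for the convolution. Each of the two sides proves one half of the theorem.

  The identity \<open>mu * eps_delta = eps_Delta\<close> gives the antipode. For \<open>J n\<close>, an ideal is any subset
  \<open>A\<close> of \<open>{1..n}\<close>, and the equation \<open>S * id = eps_Delta\<close> becomes a recursion that determines
  \<open>S (J n)\<close> from the \<open>S (J m)\<close> with \<open>m < n\<close>: the sum over \<open>A\<close> of
  \<open>S (J (n - card A))\<close> times the product of the \<open>J (card I)\<close>, for \<open>I\<close> a maximal interval of \<open>A\<close>,
  vanishes. The proposed value of \<open>S (J n)\<close> satisfies the same recursion: a noncrossing partition \<open>P\<close>
  of \<open>{1..n} - A\<close> together with the maximal intervals of \<open>A\<close> is a noncrossing partition of \<open>{1..n}\<close>
  with a distinguished set of blocks, and these sets are exactly the ideals on which \<open>eps_delta\<close>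
  does not vanish. Hence the sum groups into values of \<open>mu * eps_delta\<close>, which are zero
  (\<open>antipode_sum_recursion\<close>, \<open>antipode_J\<close>).

  The identity \<open>eps_delta * mu = eps_Delta\<close> computes \<open>mu\<close>. The character \<open>eps_delta\<close> only keeps the
  ideals that miss at most one block, and the block that is missed must be outer, that is, not nested in
  another block. So \<open>mu \<pi>\<close> is minus the sum, over the outer blocks \<open>b\<close>, of the product of the values of
  \<open>mu\<close> on the pieces into which \<open>\<pi>\<close> falls when \<open>b\<close> is removed. The outer blocks form one class of
  \<open>sim \<pi>\<close>, a chain of consecutive adjacent blocks (\<open>outer_chain_class\<close>). Removing its \<open>i\<close>-th element
  cuts a chain of length \<open>k\<close> into chains of lengths \<open>i - 1\<close> and \<open>k - i\<close> and leaves the other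
  classes alone, so that, up to sign, the product of the Catalan numbers of the classes satisfies the
  same recursion, by the Catalan convolution (\<open>sum_chain_weight_remove\<close>, \<open>mu_gen\<close>).

  Grouping the partitions by their block sizes and reading off the coefficient of the
  partition into singletons, which is a single chain of length \<open>n\<close>, completes the proof.
\<close>

section \<open>The Catalan convolution\<close>

lemma cat_0 [simp]: "cat 0 = 1"
  by (simp add: cat_def)

lemma cat_Suc: "of_nat (n + 2) * cat (Suc n) = (of_nat (4 * n + 2) * cat n :: 'k::field_char_0)"
proof -
  have "(2 * n + 2 choose (n + 1)) * (n + 1) = (2 * n + 2) * (2 * n + 1 choose n)"
    using Suc_times_binomial_eq[of "2 * n + 1" n] by simp
  moreover have "(2 * n + 1 choose n) * (n + 1) = (2 * n + 1) * (2 * n choose n)"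
    using Suc_times_binomial_eq[of "2 * n" n] binomial_symmetric[of n "2 * n + 1"] by simp
  ultimately have "(2 * n + 2 choose (n + 1)) * (n + 1) * (n + 1)
      = (2 * n + 2) * ((2 * n + 1) * (2 * n choose n))"
    by (metis mult.assoc)
  also have "\<dots> = (4 * n + 2) * (2 * n choose n) * (n + 1)"
    by (simp add: algebra_simps)
  finally have "(2 * n + 2 choose (n + 1)) * (n + 1) = (4 * n + 2) * (2 * n choose n)"
    unfolding mult_cancel2 by simp
  then have "of_nat ((2 * n + 2 choose (n + 1)) * (n + 1)) =
      (of_nat ((4 * n + 2) * (2 * n choose n)) :: 'k)"
    by (rule arg_cong)
  moreover have "of_nat (n + 2) \<noteq> (0 :: 'k)" "of_nat (n + 1) \<noteq> (0 :: 'k)"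
    unfolding of_nat_eq_0_iff by simp_all
  ultimately show ?thesis
    unfolding cat_def of_nat_mult by (simp add: field_simps del: of_nat_add of_nat_Suc binomial_Suc_Suc)
qed

text \<open>Let \<open>s m\<close> be the sum of all \<open>cat i * cat (m - i)\<close>. In the induction step, weighting the summands
  of \<open>s (n + 1)\<close> by \<open>i + 1\<close> gives a sum that can be evaluated in two ways. By the symmetry
  \<open>i \<leftrightarrow> n + 1 - i\<close> the weighted sum is \<open>(n + 3) / 2\<close> times \<open>s (n + 1)\<close>, and by the
  recursion for \<open>(i + 1) * cat i\<close> it is \<open>cat (n + 1) + (2 * n + 2) * s n\<close>, which the induction
  hypothesis evaluates.\<close>

lemma cat_convolution: "(\<Sum>i\<le>n. cat i * cat (n - i)) = (cat (Suc n) :: 'k::field_char_0)"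
proof (induction n)
  case 0
  show ?case by (simp add: cat_def)
next
  case (Suc n)
  define s where "s = (\<lambda>m. \<Sum>i\<le>m. cat i * cat (m - i) :: 'k)"
  have sym: "2 * (\<Sum>i\<le>m. of_nat i * cat i * cat (m - i)) = (of_nat m * s m :: 'k)" for m
  proof -
    have "(\<Sum>i\<le>m. of_nat i * cat i * cat (m - i)) = (\<Sum>i\<le>m. of_nat (m - i) * cat i * cat (m - i) :: 'k)"
      by (rule sum.reindex_bij_witness[of _ "\<lambda>i. m - i" "\<lambda>i. m - i"]) (auto simp: mult_ac)
    then have "2 * (\<Sum>i\<le>m. of_nat i * cat i * cat (m - i)) =
       (\<Sum>i\<le>m. of_nat i * cat i * cat (m - i) + of_nat (m - i) * cat i * cat (m - i) :: 'k)"
      by (simp add: sum.distrib)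
    also have "\<dots> = of_nat m * s m"
      unfolding s_def sum_distrib_left
      by (rule sum.cong) (auto simp: of_nat_diff algebra_simps)
    finally show ?thesis .
  qed
  have "(\<Sum>i\<le>Suc n. of_nat (i + 1) * cat i * cat (Suc n - i)) =
      cat (Suc n) + (\<Sum>i\<le>n. of_nat (i + 2) * cat (Suc i) * cat (n - i) :: 'k)"
    by (subst sum.atMost_Suc_shift) simp
  also have "\<dots> = cat (Suc n) + (\<Sum>i\<le>n. 4 * (of_nat i * cat i * cat (n - i)) + 2 * (cat i * cat (n - i)))"
    unfolding cat_Suc by (simp add: algebra_simps)
  also have "\<dots> = cat (Suc n) + (2 * (2 * (\<Sum>i\<le>n. of_nat i * cat i * cat (n - i))) + 2 * s n)"
    by (simp add: sum.distrib s_def flip: sum_distrib_left)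
  also have "\<dots> = of_nat (2 * n + 3) * cat (Suc n)"
    unfolding sym using Suc by (simp add: s_def algebra_simps)
  finally have "2 * (\<Sum>i\<le>Suc n. of_nat (i + 1) * cat i * cat (Suc n - i)) =
      2 * (of_nat (2 * n + 3) * cat (Suc n) :: 'k)"
    by (rule arg_cong)
  also have "\<dots> = of_nat (n + 3) * cat (Suc (Suc n))"
    using cat_Suc[of "Suc n", where 'k = 'k] by (simp add: algebra_simps)
  also have "2 * (\<Sum>i\<le>Suc n. of_nat (i + 1) * cat i * cat (Suc n - i)) =
      2 * (\<Sum>i\<le>Suc n. of_nat i * cat i * cat (Suc n - i)) + 2 * s (Suc n)"
    unfolding s_def distrib_left[symmetric] sum.distrib[symmetric]
    by (rule arg_cong, rule sum.cong) (simp_all add: algebra_simps)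
  also have "\<dots> = of_nat (n + 3) * s (Suc n)"
    unfolding sym by (simp add: algebra_simps)
  finally have "of_nat (n + 3) * s (Suc n) = of_nat (n + 3) * cat (Suc (Suc n))" .
  moreover have "of_nat (n + 3) \<noteq> (0::'k)"
    unfolding of_nat_eq_0_iff by simp_all
  ultimately have "s (Suc n) = cat (Suc (Suc n))"
    unfolding mult_cancel_left by simp
  then show ?case
    by (simp only: s_def)
qed

lemma sum_ranks:
  fixes X :: "nat set"
  assumes "finite X"
  shows "(\<Sum>x\<in>X. f (card {y\<in>X. y < x}) (card {y\<in>X. x < y})) = (\<Sum>i<card X. f i (card X - 1 - i))"
proof -
  define r where "r = (\<lambda>x. card {y\<in>X. y < x})"
  have less: "r x < r y" if "x \<in> X" "x < y" for x y
    unfolding r_def using assms that by (intro psubset_card_mono) auto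
  have inj: "inj_on r X"
    by (intro linorder_inj_onI) (use less in force)+
  have "r ` X \<subseteq> {..<card X}"
    unfolding r_def using assms by (auto intro!: psubset_card_mono)
  then have img: "r ` X = {..<card X}"
    by (intro card_subset_eq) (auto simp: card_image[OF inj])
  have "card {y\<in>X. x < y} = card X - 1 - r x" if "x \<in> X" for x
  proof -
    have "X = {y\<in>X. y < x} \<union> {x} \<union> {y\<in>X. x < y}"
      using that by auto
    then have "card X = card ({y\<in>X. y < x} \<union> {x} \<union> {y\<in>X. x < y})"
      by simp
    also have "\<dots> = r x + 1 + card {y\<in>X. x < y}"
      using assms by (subst card_Un_disjoint; (subst card_Un_disjoint)?) (auto simp: r_def)
    finally show ?thesis by simp
  qed
  then have "(\<Sum>x\<in>X. f (r x) (card {y\<in>X. x < y})) = (\<Sum>x\<in>X. f (r x) (card X - 1 - r x))"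
    by simp
  also have "\<dots> = (\<Sum>i\<in>r ` X. f i (card X - 1 - i))"
    using inj by (simp add: sum.reindex)
  finally show ?thesis
    unfolding img by (simp add: r_def)
qed

text \<open>The Catalan convolution, stated for the ways of splitting a linearly ordered set at one of its
  elements. It will be applied to the left ends of the blocks in a chain.\<close>

lemma sum_cat_ranks:
  fixes X :: "nat set"
  assumes "finite X" "X \<noteq> {}"
  shows "(\<Sum>x\<in>X. cat (card {y\<in>X. y < x}) * cat (card {y\<in>X. x < y})) = (cat (card X) :: 'k::field_char_0)"
proof -
  obtain m where m: "card X = Suc m"
    using assms by (metis card_eq_0_iff not0_implies_Suc)
  show ?thesis
    unfolding sum_ranks[OF assms(1), of "\<lambda>i j. cat i * cat j"] m
    using cat_convolution[of m, where 'k = 'k] by (simp add: lessThan_Suc_atMost)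
qed

section \<open>Evaluating the coproduct on a noncrossing partition\<close>

lemma is_ncp_blocks: "is_ncp (blocks \<pi>)"
  using blocks[of \<pi>] by simp

lemma blocks_Abs_ncp: "is_ncp P \<Longrightarrow> blocks (Abs_ncp P) = P"
  by (simp add: Abs_ncp_inverse)

lemma finite_is_ncp: "is_ncp P \<Longrightarrow> finite P"
  using finite_elements[of "{1..n}" P for n] by (auto simp: is_ncp_def)

lemma finite_blocks: "finite (blocks \<pi>)"
  by (rule finite_is_ncp[OF is_ncp_blocks])

lemma alg_extend_gen: "\<iota> 1 = 1 \<Longrightarrow> alg_extend \<iota> f (gen \<pi>) = f \<pi>"
  by (simp add: alg_extend_def gen_def)

lemma alg_extend_one: "\<iota> 1 = 1 \<Longrightarrow> alg_extend \<iota> f 1 = 1"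
  unfolding single_one[symmetric] by (simp add: alg_extend_def del: single_one)

lemma tensor_lift_superset:
  assumes "\<iota> 0 = 0" "finite A" "Poly_Mapping.keys t \<subseteq> A"
  shows "tensor_lift \<iota> B t =
    (\<Sum>p\<in>A. \<iota> (Poly_Mapping.lookup t p) *
       B (Poly_Mapping.single (fst p) 1) (Poly_Mapping.single (snd p) 1))"
  unfolding tensor_lift_def case_prod_beta prod.collapse
  using assms by (intro sum.mono_neutral_left) (auto simp: in_keys_iff)

lemma tensor_lift_add:
  assumes "\<iota> 0 = 0" "\<And>a b. \<iota> (a + b) = \<iota> a + \<iota> b"
  shows "tensor_lift \<iota> B (s + t) = tensor_lift \<iota> B s + tensor_lift \<iota> B t"
proof -
  define A where "A = Poly_Mapping.keys s \<union> Poly_Mapping.keys t"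
  have "finite A" "Poly_Mapping.keys s \<subseteq> A" "Poly_Mapping.keys t \<subseteq> A" "Poly_Mapping.keys (s + t) \<subseteq> A"
    using Poly_Mapping.keys_add[of s t] by (auto simp: A_def)
  then show ?thesis
    using assms by (simp add: tensor_lift_superset[of \<iota> A] lookup_add distrib_right sum.distrib)
qed

lemma tensor_lift_sum:
  assumes "\<iota> 0 = 0" "\<And>a b. \<iota> (a + b) = \<iota> a + \<iota> b"
  shows "tensor_lift \<iota> B (\<Sum>i\<in>A. t i) = (\<Sum>i\<in>A. tensor_lift \<iota> B (t i))"
proof (induction A rule: infinite_finite_induct)
  case (insert x F)
  then show ?case
    using assms by (simp add: tensor_lift_add)
qed (simp_all add: tensor_lift_def)

lemma tensor_lift_tensor_monomials:
  assumes "\<iota> 1 = 1"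
  shows "tensor_lift \<iota> B (tensor (Poly_Mapping.single m 1) (Poly_Mapping.single m' 1)) =
    B (Poly_Mapping.single m 1) (Poly_Mapping.single m' 1)"
  using assms by (simp add: tensor_lift_def tensor_def)

lemma restriction_monomial: "\<exists>m. restriction Y = Poly_Mapping.single m 1"
  by (cases "Y = {}") (auto simp: restriction_def gen_def simp flip: single_one)

lemma dot_restriction_monomial: "\<exists>m. dot_restriction Y = Poly_Mapping.single m 1"
proof -
  have "\<exists>m. (\<Prod>I\<in>A. restriction {b \<in> Y. b \<subseteq> I}) = (Poly_Mapping.single m 1 :: 'k::comm_ring_1 ncp_alg)" for A
  proof (induction A rule: infinite_finite_induct)
    case (insert x F)
    obtain m m' where "restriction {b \<in> Y. b \<subseteq> x} = (Poly_Mapping.single m 1 :: 'k ncp_alg)"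
        "(\<Prod>I\<in>F. restriction {b \<in> Y. b \<subseteq> I}) = (Poly_Mapping.single m' 1 :: 'k ncp_alg)"
      using insert restriction_monomial by blast
    then have "(\<Prod>I\<in>insert x F. restriction {b \<in> Y. b \<subseteq> I}) = (Poly_Mapping.single (m + m') 1 :: 'k ncp_alg)"
      using insert by (simp add: mult_single)
    then show ?case
      by blast
  qed (auto simp flip: single_one)
  then show ?thesis
    by (simp add: dot_restriction_def)
qed

text \<open>Both tensor factors of each summand of \<open>Delta (gen \<pi>)\<close> are monomials, so the summand is a basis
  vector of the tensor square, and there \<open>tensor_lift\<close> evaluates \<open>B\<close>.\<close>

lemma tensor_lift_Delta_gen:
  fixes \<iota> :: "'k::comm_ring_1 \<Rightarrow> 'b::comm_ring_1"
  assumes "\<iota> 0 = 0" "\<And>a b. \<iota> (a + b) = \<iota> a + \<iota> b" "\<iota> 1 = 1"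
  shows "tensor_lift \<iota> B (Delta (gen \<pi>)) =
    (\<Sum>Y | is_ideal \<pi> Y. B (restriction (blocks \<pi> - Y)) (dot_restriction Y))"
proof -
  have "tensor_lift \<iota> B (tensor (restriction X) (dot_restriction Y)) =
      B (restriction X) (dot_restriction Y)" for X Y
  proof -
    obtain m m' where "restriction X = (Poly_Mapping.single m 1 :: 'k ncp_alg)"
        "dot_restriction Y = (Poly_Mapping.single m' 1 :: 'k ncp_alg)"
      using restriction_monomial dot_restriction_monomial by blast
    then show ?thesis
      using tensor_lift_tensor_monomials[of \<iota> B] assms(3) by simp
  qed
  then show ?thesis
    using assms by (simp add: Delta_def alg_extend_gen tensor_lift_sum)
qed

lemma tensor_lift_Delta_one:
  fixes \<iota> :: "'k::comm_ring_1 \<Rightarrow> 'b::comm_ring_1"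
  assumes "\<iota> 1 = 1"
  shows "tensor_lift \<iota> B (Delta 1) = B 1 1"
proof -
  have "Delta (1 :: 'k ncp_alg) = tensor 1 1"
    unfolding Delta_def by (simp add: alg_extend_one tensor_def flip: zero_prod_def)
  then show ?thesis
    using tensor_lift_tensor_monomials[of \<iota> B 0 0] assms by simp
qed

lemma finite_ideals: "finite {Y. is_ideal \<pi> Y}"
  by (rule finite_subset[of _ "Pow (blocks \<pi>)"]) (auto simp: is_ideal_def finite_blocks)

lemma antipode_one:
  assumes "is_antipode S"
  shows "S 1 = 1"
proof -
  have "S 1 * 1 = scalar (eps_Delta 1)"
    using assms tensor_lift_Delta_one[of scalar "\<lambda>u v. S u * v"]
    by (simp add: is_antipode_def)
  then show ?thesis
    by (simp add: eps_Delta_def alg_extend_one)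
qed

text \<open>This recovers \<open>S (gen \<pi>)\<close>, the summand for the empty ideal, from the values of \<open>S\<close> on partitions
  with fewer blocks.\<close>

lemma antipode_recursion:
  assumes "is_antipode S"
  shows "(\<Sum>Y | is_ideal \<pi> Y. S (restriction (blocks \<pi> - Y)) * dot_restriction Y) = 0"
proof -
  have "(\<Sum>Y | is_ideal \<pi> Y. S (restriction (blocks \<pi> - Y)) * dot_restriction Y) =
      tensor_lift scalar (\<lambda>u v. S u * v) (Delta (gen \<pi>))"
    by (subst tensor_lift_Delta_gen) (simp_all add: single_add)
  also have "\<dots> = scalar (eps_Delta (gen \<pi>))"
    using assms by (simp add: is_antipode_def)
  finally show ?thesis
    by (simp add: eps_Delta_def alg_extend_gen)
qed

section \<open>The characters given by values of the polynomial invariant\<close>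

lemma poly_poly_tensor: "poly (poly (poly_tensor p q) [:b:]) a = poly p a * poly q b"
proof -
  have "poly (map_poly (\<lambda>c. [:c:]) q) [:b:] = [:poly q b:]"
    by (induction q) (simp_all add: map_poly_pCons)
  then show ?thesis
    by (simp add: poly_tensor_def)
qed

lemma poly_poly_Delta: "poly (poly (poly_Delta p) [:b:]) a = poly p (a + b)"
proof -
  have "poly (poly (poly (map_poly (\<lambda>c. [:[:c:]:]) p) t) [:b:]) a = poly p (poly (poly t [:b:]) a)" for t
    by (induction p) (simp_all add: map_poly_pCons)
  then show ?thesis
    by (simp add: poly_Delta_def poly_poly_tensor)
qed

text \<open>Evaluating compatibility with \<open>Delta\<close> at \<open>X \<otimes> 1 = a\<close>, \<open>1 \<otimes> X = b\<close>. With \<open>{a, b} = {1, -1}\<close>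
  it becomes the statement that \<open>mu\<close> is the convolution inverse of \<open>eps_delta\<close>.\<close>

lemma phi_convolution:
  assumes "is_phi \<phi>"
  shows "(\<Sum>Y | is_ideal \<pi> Y. poly (\<phi> (restriction (blocks \<pi> - Y))) a * poly (\<phi> (dot_restriction Y)) b)
    = poly (\<phi> (gen \<pi>)) (a + b)"
proof -
  have "tensor_lift (\<lambda>c. [:[:c:]:]) (\<lambda>u v. poly_tensor (\<phi> u) (\<phi> v)) (Delta (gen \<pi>)) = poly_Delta (\<phi> (gen \<pi>))"
    using assms unfolding is_phi_def by blast
  also have "tensor_lift (\<lambda>c. [:[:c:]:]) (\<lambda>u v. poly_tensor (\<phi> u) (\<phi> v)) (Delta (gen \<pi>)) =
      (\<Sum>Y | is_ideal \<pi> Y. poly_tensor (\<phi> (restriction (blocks \<pi> - Y))) (\<phi> (dot_restriction Y)))"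
    by (subst tensor_lift_Delta_gen) (simp_all flip: one_pCons)
  finally have "poly (poly (\<Sum>Y | is_ideal \<pi> Y. poly_tensor (\<phi> (restriction (blocks \<pi> - Y))) (\<phi> (dot_restriction Y))) [:b:]) a
      = poly (\<phi> (gen \<pi>)) (a + b)"
    by (simp only: poly_poly_Delta)
  then show ?thesis
    by (simp add: poly_sum poly_poly_tensor)
qed

lemma phi_one: "is_phi \<phi> \<Longrightarrow> \<phi> 1 = 1"
  by (simp add: is_phi_def)

lemma phi_zero: "is_phi \<phi> \<Longrightarrow> poly (\<phi> (gen \<pi>)) 0 = 0"
  by (simp add: is_phi_def eps_Delta_def alg_extend_gen)

lemma phi_at_1: "is_phi \<phi> \<Longrightarrow> poly (\<phi> (gen \<pi>)) 1 = (if card (blocks \<pi>) = 1 then 1 else 0)"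
  by (simp add: is_phi_def eps_delta_def alg_extend_gen)

lemma phi_prod:
  assumes "is_phi \<phi>"
  shows "\<phi> (\<Prod>i\<in>A. f i) = (\<Prod>i\<in>A. \<phi> (f i))"
  by (induction A rule: infinite_finite_induct) (use assms in \<open>simp_all add: is_phi_def\<close>)

lemma phi_dot_restriction:
  assumes "is_phi \<phi>"
  shows "poly (\<phi> (dot_restriction Y)) a =
    (\<Prod>I\<in>intervals_of (\<Union>Y). poly (\<phi> (restriction {b \<in> Y. b \<subseteq> I})) a)"
  by (simp add: dot_restriction_def phi_prod[OF assms] poly_prod)

section \<open>Noncrossing partitions of a finite set of integers\<close>

text \<open>Removing blocks from a partition of \<open>{1..n}\<close> leaves a partition of a smaller set, which need not
  be an initial interval. Keeping the original numbers, and renumbering only where the algebra demands it,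
  makes the pieces of a partition comparable with the partition itself.\<close>

definition nc_partitions :: "nat set \<Rightarrow> nat set set set" where
  "nc_partitions U = {P. partition_on U P \<and> noncrossing P}"

lemma nc_partitionsD:
  assumes "P \<in> nc_partitions U"
  shows "\<Union>P = U" "{} \<notin> P" "\<And>b c. b \<in> P \<Longrightarrow> c \<in> P \<Longrightarrow> b \<noteq> c \<Longrightarrow> b \<inter> c = {}"
    and "\<And>b c x y z t. b \<in> P \<Longrightarrow> c \<in> P \<Longrightarrow> x \<in> b \<Longrightarrow> z \<in> b \<Longrightarrow> y \<in> c \<Longrightarrow> t \<in> c \<Longrightarrow>
      x < y \<Longrightarrow> y < z \<Longrightarrow> z < t \<Longrightarrow> b = c"
proof -
  have *: "partition_on U P" "noncrossing P"
    using assms by (simp_all add: nc_partitions_def)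
  show "\<Union>P = U" "{} \<notin> P"
    using *(1) by (auto simp: partition_on_def)
  show "b \<inter> c = {}" if "b \<in> P" "c \<in> P" "b \<noteq> c" for b c
    using disjointD[OF partition_onD2[OF *(1)]] that by blast
  show "b = c" if "b \<in> P" "c \<in> P" "x \<in> b" "z \<in> b" "y \<in> c" "t \<in> c" "x < y" "y < z" "z < t" for b c x y z t
    using *(2)[unfolded noncrossing_def, rule_format, OF that(1,2)] that(3-) by blast
qed

lemma nc_partitionsI:
  assumes "\<Union>P = U" "{} \<notin> P" "\<And>b c. b \<in> P \<Longrightarrow> c \<in> P \<Longrightarrow> b \<noteq> c \<Longrightarrow> b \<inter> c = {}"
    and "\<And>b c x y z t. b \<in> P \<Longrightarrow> c \<in> P \<Longrightarrow> x \<in> b \<Longrightarrow> z \<in> b \<Longrightarrow> y \<in> c \<Longrightarrow> t \<in> c \<Longrightarrow>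
      x < y \<Longrightarrow> y < z \<Longrightarrow> z < t \<Longrightarrow> b = c"
  shows "P \<in> nc_partitions U"
proof -
  have "noncrossing P"
    unfolding noncrossing_def by (intro ballI impI notI) (elim bexE conjE, drule (8) assms(4), simp)
  then show ?thesis
    using assms(1-3) unfolding nc_partitions_def partition_on_def disjoint_def by simp
qed

lemma nc_partitions_subset: "P \<in> nc_partitions U \<Longrightarrow> Q \<subseteq> P \<Longrightarrow> Q \<in> nc_partitions (\<Union>Q)"
proof (rule nc_partitionsI)
  assume *: "P \<in> nc_partitions U" "Q \<subseteq> P"
  note P = nc_partitionsD[OF *(1)]
  show "{} \<notin> Q"
    using P(2) * by blast
  show "b \<inter> c = {}" if "b \<in> Q" "c \<in> Q" "b \<noteq> c" for b c
    using P(3) * that by blast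
  show "b = c" if "b \<in> Q" "c \<in> Q" "x \<in> b" "z \<in> b" "y \<in> c" "t \<in> c" "x < y" "y < z" "z < t" for b c x y z t
    by (rule P(4)[OF _ _ that(3-)]) (use * that(1,2) in blast)+
qed simp

lemma finite_nc_partitions: "finite U \<Longrightarrow> finite (nc_partitions U)"
  by (rule finite_subset[of _ "Pow (Pow U)"]) (auto simp: nc_partitions_def partition_on_def)

lemma finite_nc_partition:
  assumes "P \<in> nc_partitions U" "finite U"
  shows "finite P" and "b \<in> P \<Longrightarrow> finite b"
  using assms finite_elements[of U P] nc_partitionsD(1)[OF assms(1)]
  by (auto simp: nc_partitions_def intro: finite_subset)

lemma nc_partitions_empty: "nc_partitions {} = {{}}"
  by (auto simp: nc_partitions_def noncrossing_def partition_on_empty)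

lemma is_ncp_iff: "is_ncp P \<longleftrightarrow> (\<exists>n\<ge>1. P \<in> nc_partitions {1..n})"
  by (auto simp: is_ncp_def nc_partitions_def)

lemma blocks_in_nc_partitions: "\<exists>n\<ge>1. blocks \<pi> \<in> nc_partitions {1..n}"
  using blocks[of \<pi>] is_ncp_iff by simp

lemma bij_betw_blocks:
  assumes "n \<ge> 1"
  shows "bij_betw blocks (NCP n) (nc_partitions {1..n})"
proof (rule bij_betw_byWitness[of _ Abs_ncp])
  have is_ncp: "is_ncp P" if "P \<in> nc_partitions {1..n}" for P
    using assms that is_ncp_iff by blast
  then show "\<forall>P\<in>nc_partitions {1..n}. blocks (Abs_ncp P) = P"
    by (simp add: Abs_ncp_inverse)
  with is_ncp show "Abs_ncp ` nc_partitions {1..n} \<subseteq> NCP n"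
    by (simp add: NCP_def image_subset_iff) (simp add: nc_partitions_def)
  show "blocks ` NCP n \<subseteq> nc_partitions {1..n}"
    using blocks by (auto simp: NCP_def nc_partitions_def is_ncp_def)
qed (simp add: blocks_inverse)

lemma nc_partitions_image:
  assumes "strict_mono_on U f" "P \<in> nc_partitions U"
  shows "(`) f ` P \<in> nc_partitions (f ` U)"
proof (rule nc_partitionsI)
  note P = nc_partitionsD[OF assms(2)]
  have less: "f x < f y \<longleftrightarrow> x < y" if "x \<in> U" "y \<in> U" for x y
    using that assms(1) by (simp add: strict_mono_on_less)
  have inj: "f x = f y \<longleftrightarrow> x = y" if "x \<in> U" "y \<in> U" for x y
    using that assms(1) by (simp add: strict_mono_on_eq)
  show "\<Union> ((`) f ` P) = f ` U"
    using P(1) by auto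
  show "{} \<notin> (`) f ` P"
    using P(2) by auto
  fix b c assume "b \<in> (`) f ` P" "c \<in> (`) f ` P"
  then obtain b' c' where b': "b' \<in> P" "c' \<in> P" "b = f ` b'" "c = f ` c'"
    by auto
  then have sub: "b' \<subseteq> U" "c' \<subseteq> U"
    using P(1) by auto
  show "b \<inter> c = {}" if "b \<noteq> c"
  proof -
    have "b' \<inter> c' = {}"
      using P(3) b' that by auto
    then show ?thesis
      using sub inj b'(3,4) by (auto simp: subset_iff disjoint_iff)
  qed
  fix x y z t assume *: "x \<in> b" "z \<in> b" "y \<in> c" "t \<in> c" "x < y" "y < z" "z < t"
  then obtain x' y' z' t' where **: "x' \<in> b'" "z' \<in> b'" "y' \<in> c'" "t' \<in> c'"
      "x = f x'" "y = f y'" "z = f z'" "t = f t'"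
    unfolding b' by blast
  have "x' < y'" "y' < z'" "z' < t'"
    using * ** sub less by (auto simp: subset_iff)
  then show "b = c"
    using P(4)[OF b'(1,2) **(1-4)] b' by auto
qed

lemma bij_betw_nc_partitions_image:
  assumes "strict_mono_on U f"
  shows "bij_betw ((`) ((`) f)) (nc_partitions U) (nc_partitions (f ` U))"
proof -
  define g where "g = the_inv_into U f"
  have inj: "inj_on f U"
    using assms by (rule strict_mono_on_imp_inj_on)
  have g: "g (f x) = x" if "x \<in> U" for x
    using that inj by (simp add: g_def the_inv_into_f_f)
  have gU: "g ` f ` U = U"
    using g by force
  have mono: "strict_mono_on (f ` U) g"
  proof (rule strict_mono_onI)
    fix r s assume "r \<in> f ` U" "s \<in> f ` U" "r < s"
    then obtain x y where "x \<in> U" "y \<in> U" "r = f x" "s = f y"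
      by blast
    with \<open>r < s\<close> show "g r < g s"
      using strict_mono_on_less[OF assms, of x y] g by simp
  qed
  show ?thesis
  proof (rule bij_betw_byWitness[of _ "(`) ((`) g)"])
    show "\<forall>P\<in>nc_partitions U. (`) g ` (`) f ` P = P"
    proof
      fix P assume "P \<in> nc_partitions U"
      then have "b \<subseteq> U" if "b \<in> P" for b
        using that nc_partitionsD(1) by blast
      then have "g ` f ` b = id b" if "b \<in> P" for b
        using that g by (simp add: image_image subset_iff)
      then have "(\<lambda>b. g ` f ` b) ` P = id ` P"
        by (intro image_cong refl)
      then show "(`) g ` (`) f ` P = P"
        by (simp add: image_image)
    qed
    show "\<forall>Q\<in>nc_partitions (f ` U). (`) f ` (`) g ` Q = Q"
    proof
      fix Q assume Q: "Q \<in> nc_partitions (f ` U)"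
      have fg: "f (g y) = y" if "y \<in> f ` U" for y
        using that g by auto
      have "b \<subseteq> f ` U" if "b \<in> Q" for b
        using that nc_partitionsD(1)[OF Q] by blast
      then have "f ` g ` b = id b" if "b \<in> Q" for b
        using that fg by (simp add: image_image subset_iff)
      then have "(\<lambda>b. f ` g ` b) ` Q = id ` Q"
        by (intro image_cong refl)
      then show "(`) f ` (`) g ` Q = Q"
        by (simp add: image_image)
    qed
    show "(`) ((`) f) ` nc_partitions U \<subseteq> nc_partitions (f ` U)"
      using nc_partitions_image[OF assms] by auto
    show "(`) ((`) g) ` nc_partitions (f ` U) \<subseteq> nc_partitions U"
      using nc_partitions_image[OF mono] gU by auto
  qed
qed

definition rank :: "nat set \<Rightarrow> nat \<Rightarrow> nat" where
  "rank U x = card {y \<in> U. y \<le> x}"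

lemma standardize_rank: "standardize P = (`) (rank (\<Union>P)) ` P"
  by (simp add: standardize_def rank_def)

lemma strict_mono_on_rank: "finite U \<Longrightarrow> strict_mono_on U (rank U)"
proof (rule strict_mono_onI)
  fix x y assume "finite U" "x \<in> U" "y \<in> U" "x < y"
  then have "{z \<in> U. z \<le> x} \<subset> {z \<in> U. z \<le> y}"
    by (intro psubsetI) (auto dest!: equalityD2 subsetD[of _ _ y])
  then show "rank U x < rank U y"
    unfolding rank_def using \<open>finite U\<close> by (intro psubset_card_mono) auto
qed

lemma rank_image:
  assumes "finite U"
  shows "rank U ` U = {1..card U}"
proof (rule card_subset_eq)
  show "rank U ` U \<subseteq> {1..card U}"
    using assms by (auto simp: rank_def Suc_le_eq card_gt_0_iff intro!: card_mono)
  show "card (rank U ` U) = card {1..card U}"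
    using strict_mono_on_imp_inj_on[OF strict_mono_on_rank[OF assms]] by (simp add: card_image)
qed simp

lemma rank_interval: "a \<le> x \<Longrightarrow> x \<le> b \<Longrightarrow> rank {a..b} x = x + 1 - a"
proof -
  assume "a \<le> x" "x \<le> b"
  then have "{y \<in> {a..b}. y \<le> x} = {a..x}"
    by auto
  then show ?thesis
    by (simp add: rank_def)
qed

text \<open>Renumbering turns sums over the noncrossing partitions of an arbitrary finite set into sums
  over \<open>NCP n\<close>.\<close>

lemma bij_betw_standardize:
  assumes "finite U"
  shows "bij_betw standardize (nc_partitions U) (nc_partitions {1..card U})"
proof -
  have "bij_betw ((`) ((`) (rank U))) (nc_partitions U) (nc_partitions {1..card U})"
    using bij_betw_nc_partitions_image[OF strict_mono_on_rank[OF assms]] by (simp add: rank_image[OF assms])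
  then show ?thesis
    by (rule bij_betw_cong[THEN iffD1, rotated]) (simp add: standardize_rank nc_partitionsD(1))
qed

lemma is_ncp_standardize_nc_partition:
  assumes "P \<in> nc_partitions U" "finite U" "U \<noteq> {}"
  shows "is_ncp (standardize P)"
  using assms bij_betwE[OF bij_betw_standardize[OF assms(2)]]
  by (auto simp: is_ncp_iff Suc_le_eq card_gt_0_iff intro!: exI[of _ "card U"])

lemma inj_on_image_rank:
  assumes "P \<in> nc_partitions U" "finite U"
  shows "inj_on ((`) (rank U)) P"
  using strict_mono_on_imp_inj_on[OF strict_mono_on_rank[OF assms(2)]] nc_partitionsD(1)[OF assms(1)]
  by (intro inj_onI) (metis Union_upper inj_on_image_eq_iff)

lemma prod_standardize:
  assumes "P \<in> nc_partitions U" "finite U"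
  shows "(\<Prod>b\<in>standardize P. f (card b)) = (\<Prod>b\<in>P. f (card b))"
proof -
  have U: "\<Union>P = U"
    using assms by (simp add: nc_partitionsD(1))
  have "card (rank U ` b) = card b" if "b \<in> P" for b
    using that U inj_on_subset[OF strict_mono_on_imp_inj_on[OF strict_mono_on_rank[OF assms(2)]]]
    by (auto intro!: card_image)
  then show ?thesis
    unfolding standardize_rank U using inj_on_image_rank[OF assms] by (simp add: prod.reindex)
qed

lemma card_standardize:
  assumes "P \<in> nc_partitions U" "finite U"
  shows "card (standardize P) = card P"
  using assms inj_on_image_rank[OF assms] by (simp add: standardize_rank nc_partitionsD(1) card_image)

lemma standardize_singletons:
  assumes "finite U"
  shows "standardize ((\<lambda>i. {i}) ` U) = (\<lambda>i. {i}) ` {1..card U}"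
  unfolding rank_image[OF assms, symmetric] by (auto simp: standardize_rank)

section \<open>Maximal intervals\<close>

lemma is_interval_nat_iff: "is_interval_nat I \<longleftrightarrow> I \<noteq> {} \<and> finite I \<and> (\<forall>x\<in>I. \<forall>y\<in>I. {x..y} \<subseteq> I)"
proof
  assume *: "I \<noteq> {} \<and> finite I \<and> (\<forall>x\<in>I. \<forall>y\<in>I. {x..y} \<subseteq> I)"
  then have "Min I \<in> I" "Max I \<in> I"
    by auto
  then have "{Min I..Max I} \<subseteq> I" "I \<subseteq> {Min I..Max I}" "Min I \<le> Max I"
    using * by (blast, auto)
  then show "is_interval_nat I"
    unfolding is_interval_nat_def by blast
qed (auto simp: is_interval_nat_def)

lemma intervals_of_ex:
  assumes "finite U" "is_interval_nat I" "I \<subseteq> U"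
  shows "\<exists>I'\<in>intervals_of U. I \<subseteq> I'"
proof -
  have "finite {I'. is_interval_nat I' \<and> I' \<subseteq> U}"
    by (rule finite_subset[of _ "Pow U"]) (use assms in auto)
  then obtain M where "M \<in> {I'. is_interval_nat I' \<and> I' \<subseteq> U}" "I \<subseteq> M"
      "\<forall>I'\<in>{I'. is_interval_nat I' \<and> I' \<subseteq> U}. M \<subseteq> I' \<longrightarrow> M = I'"
    using finite_has_maximal2[of "{I'. is_interval_nat I' \<and> I' \<subseteq> U}" I] assms by auto
  then show ?thesis
    by (auto simp: intervals_of_def)
qed

lemma intervals_ofD:
  assumes "I \<in> intervals_of U"
  shows "is_interval_nat I" "I \<noteq> {}" "finite I" "I \<subseteq> U" "\<And>x y. x \<in> I \<Longrightarrow> y \<in> I \<Longrightarrow> {x..y} \<subseteq> I"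
proof -
  show *: "is_interval_nat I" and "I \<subseteq> U"
    using assms unfolding intervals_of_def by simp_all
  show "I \<noteq> {}" "finite I" "\<And>x y. x \<in> I \<Longrightarrow> y \<in> I \<Longrightarrow> {x..y} \<subseteq> I"
    using * unfolding is_interval_nat_iff by blast+
qed

text \<open>The union of two intervals that meet is an interval, so maximality of \<open>I\<close> leaves no room for
  a part of \<open>K\<close> outside.\<close>

lemma intervals_of_absorb:
  assumes "finite U" "I \<in> intervals_of U" "is_interval_nat K" "K \<subseteq> U" "I \<inter> K \<noteq> {}"
  shows "K \<subseteq> I"
proof -
  obtain a b c d where ab: "a \<le> b" "I = {a..b}" "c \<le> d" "K = {c..d}"
    using assms unfolding intervals_of_def is_interval_nat_def by auto
  have "I \<union> K = {min a c..max b d}"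
    using assms(5) unfolding ab by auto
  moreover have "min a c \<le> max b d"
    using ab by auto
  ultimately have "is_interval_nat (I \<union> K)"
    unfolding is_interval_nat_def by blast
  then have "I \<union> K = I"
    using assms unfolding intervals_of_def by blast
  then show ?thesis by blast
qed

lemma intervals_of_disjoint:
  assumes "finite U" "I \<in> intervals_of U" "I' \<in> intervals_of U" "I \<noteq> I'"
  shows "I \<inter> I' = {}"
  using intervals_of_absorb[OF assms(1,2), of I'] intervals_of_absorb[OF assms(1,3), of I] assms
  by (auto simp: intervals_of_def)

lemma intervals_of_Suc:
  assumes "finite U" "I \<in> intervals_of U" "x \<in> I" "x + 1 \<in> U"
  shows "x + 1 \<in> I"
proof -
  have "is_interval_nat {x..x + 1}"
    unfolding is_interval_nat_def by (intro exI[of _ x] exI[of _ "x + 1"]) simp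
  moreover have "{x..x + 1} \<subseteq> U"
  proof
    fix y assume "y \<in> {x..x + 1}"
    then have "y = x \<or> y = x + 1"
      by auto
    then show "y \<in> U"
      using assms intervals_ofD(4)[OF assms(2)] by blast
  qed
  moreover have "I \<inter> {x..x + 1} \<noteq> {}"
    using assms(3) by auto
  ultimately have "{x..x + 1} \<subseteq> I"
    by (rule intervals_of_absorb[OF assms(1,2)])
  then show ?thesis by (simp add: subset_iff)
qed

lemma Union_intervals_of:
  assumes "finite U"
  shows "\<Union> (intervals_of U) = U"
proof
  show "U \<subseteq> \<Union> (intervals_of U)"
  proof
    fix x assume "x \<in> U"
    then show "x \<in> \<Union> (intervals_of U)"
      using intervals_of_ex[OF assms, of "{x}"] by (auto simp: is_interval_nat_iff)
  qed
qed (auto simp: intervals_of_def)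

lemma finite_intervals_of: "finite U \<Longrightarrow> finite (intervals_of U)"
  by (rule finite_subset[of _ "Pow U"]) (auto simp: intervals_of_def)

lemma intervals_of_empty [simp]: "intervals_of {} = {}"
  by (auto simp: intervals_of_def is_interval_nat_iff)

lemma intervals_of_interval:
  assumes "is_interval_nat I"
  shows "intervals_of I = {I}"
  using assms by (auto simp: intervals_of_def)

section \<open>Chains of adjacent blocks\<close>

text \<open>The relations \<open>adjacent\<close> and \<open>sim\<close> for families of blocks that are not numbered consecutively from \<open>1\<close>.\<close>

definition adj :: "nat set set \<Rightarrow> (nat set \<times> nat set) set" where
  "adj Q = {(b, c) \<in> Q \<times> Q. Max b + 1 = Min c}"

definition chain_rel :: "nat set set \<Rightarrow> (nat set \<times> nat set) set" where
  "chain_rel Q = {(b, c) \<in> Q \<times> Q. (b, c) \<in> (adj Q)\<^sup>* \<or> (c, b) \<in> (adj Q)\<^sup>*}"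

lemma sim_eq_chain_rel: "sim \<pi> = chain_rel (blocks \<pi>)"
  by (simp add: sim_def adjacent_def chain_rel_def adj_def)

definition chain_weight :: "nat set set \<Rightarrow> 'k::field_char_0" where
  "chain_weight Q = (\<Prod>C\<in>Q // chain_rel Q. cat (card C))"

lemma quotient_chain_rel: "Q // chain_rel Q = (\<lambda>b. chain_rel Q `` {b}) ` Q"
  by (auto simp: quotient_def)

lemma chain_rel_class: "chain_rel Q `` {b} = {c. b \<in> Q \<and> c \<in> Q \<and> ((b, c) \<in> (adj Q)\<^sup>* \<or> (c, b) \<in> (adj Q)\<^sup>*)}"
  by (auto simp: chain_rel_def)

context
  fixes Q :: "nat set set" and U :: "nat set"
  assumes Q: "Q \<in> nc_partitions U" and U: "finite U"
begin

lemma block_Min_Max: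
  assumes "b \<in> Q"
  shows "Min b \<in> b" "Max b \<in> b" "Min b \<le> Max b" "b \<subseteq> {Min b..Max b}"
proof -
  have b: "finite b" "b \<noteq> {}"
    using assms finite_nc_partition(2)[OF Q U assms] nc_partitionsD(2)[OF Q] by auto
  then show "Min b \<in> b" "Max b \<in> b" "b \<subseteq> {Min b..Max b}"
    by auto
  with b show "Min b \<le> Max b"
    by simp
qed

lemma block_eq: "b \<in> Q \<Longrightarrow> c \<in> Q \<Longrightarrow> x \<in> b \<Longrightarrow> x \<in> c \<Longrightarrow> b = c"
  using nc_partitionsD(3)[OF Q] by blast

lemma adj_Min_less: "(b, c) \<in> adj Q \<Longrightarrow> Min b < Min c"
  using block_Min_Max(3)[of b] by (auto simp: adj_def)

text \<open>A block is determined by its minimum and by its maximum, so the graph of adjacency is a disjoint union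
  of paths.\<close>

lemma single_valued_adj: "single_valued (adj Q)" "single_valued ((adj Q)\<inverse>)"
proof -
  show "single_valued (adj Q)"
  proof (rule single_valuedI)
    fix b c d assume "(b, c) \<in> adj Q" "(b, d) \<in> adj Q"
    then have "c \<in> Q" "d \<in> Q" "Min c = Min d"
      by (auto simp: adj_def)
    then show "c = d"
      using block_eq block_Min_Max(1) by metis
  qed
  show "single_valued ((adj Q)\<inverse>)"
  proof (rule single_valuedI)
    fix b c d assume "(b, c) \<in> (adj Q)\<inverse>" "(b, d) \<in> (adj Q)\<inverse>"
    then have "c \<in> Q" "d \<in> Q" "Max c = Max d"
      by (auto simp: adj_def)
    then show "c = d"
      using block_eq block_Min_Max(2) by metis
  qed
qed

lemma adj_forward: "(b, c) \<in> (adj Q)\<^sup>* \<Longrightarrow> (b, d) \<in> (adj Q)\<^sup>* \<Longrightarrow> (c, d) \<in> (adj Q)\<^sup>* \<or> (d, c) \<in> (adj Q)\<^sup>*"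
  using single_valued_confluent[OF single_valued_adj(1)] by blast

lemma adj_backward: "(c, b) \<in> (adj Q)\<^sup>* \<Longrightarrow> (d, b) \<in> (adj Q)\<^sup>* \<Longrightarrow> (c, d) \<in> (adj Q)\<^sup>* \<or> (d, c) \<in> (adj Q)\<^sup>*"
  using single_valued_confluent[OF single_valued_adj(2), of b c d] unfolding rtrancl_converse by blast

lemma adj_rtrancl_Min: "(b, c) \<in> (adj Q)\<^sup>* \<Longrightarrow> b = c \<or> Min b < Min c"
  by (induction rule: rtrancl_induct) (auto dest: adj_Min_less)

lemma adj_rtrancl_antisym: "(b, c) \<in> (adj Q)\<^sup>* \<Longrightarrow> (c, b) \<in> (adj Q)\<^sup>* \<Longrightarrow> b = c"
  using adj_rtrancl_Min[of b c] adj_rtrancl_Min[of c b] by auto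

lemma equiv_chain_rel: "equiv Q (chain_rel Q)"
proof (rule equivI)
  show "trans (chain_rel Q)"
  proof (rule transI)
    fix b c d assume "(b, c) \<in> chain_rel Q" "(c, d) \<in> chain_rel Q"
    then show "(b, d) \<in> chain_rel Q"
      using adj_forward[of c b d] adj_backward[of b c d] rtrancl_trans[of b c "adj Q" d]
        rtrancl_trans[of d c "adj Q" b]
      unfolding chain_rel_def by blast
  qed
qed (auto simp: chain_rel_def refl_on_def sym_def)

text \<open>Adjacency is a union of paths, so there is only one way from \<open>c\<close> to \<open>d\<close>, and removing \<open>b\<close>
  breaks it precisely when it runs through \<open>b\<close>.\<close>

lemma adj_remove_iff:
  assumes "c \<in> Q - {b}" "d \<in> Q - {b}"
  shows "(c, d) \<in> (adj (Q - {b}))\<^sup>* \<longleftrightarrow>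
    (c, d) \<in> (adj Q)\<^sup>* \<and> \<not> ((c, b) \<in> (adj Q)\<^sup>* \<and> (b, d) \<in> (adj Q)\<^sup>*)"
proof
  have sub: "adj (Q - {b}) \<subseteq> adj Q"
    by (auto simp: adj_def)
  assume *: "(c, d) \<in> (adj (Q - {b}))\<^sup>*"
  have "\<not> ((c, b) \<in> (adj Q)\<^sup>* \<and> (b, d) \<in> (adj Q)\<^sup>*)"
    using *
  proof (induction rule: rtrancl_induct)
    case base
    show ?case
      using assms(1) adj_rtrancl_antisym by blast
  next
    case (step d e)
    have de: "(d, e) \<in> adj Q" "e \<noteq> b"
      using step(2) by (auto simp: adj_def)
    \<comment> \<open>The only predecessor of \<open>e\<close> is \<open>d\<close>, so a path through \<open>b \<noteq> e\<close> to \<open>e\<close> already runs through \<open>b\<close> before \<open>d\<close>.\<close>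
    show ?case
    proof
      assume cb: "(c, b) \<in> (adj Q)\<^sup>* \<and> (b, e) \<in> (adj Q)\<^sup>*"
      then obtain d' where "(b, d') \<in> (adj Q)\<^sup>*" "(d', e) \<in> adj Q"
        using de(2) by (metis rtranclE)
      moreover from this de have "d' = d"
        using single_valuedD[OF single_valued_adj(2)] by blast
      ultimately show False
        using step.IH cb by blast
    qed
  qed
  then show "(c, d) \<in> (adj Q)\<^sup>* \<and> \<not> ((c, b) \<in> (adj Q)\<^sup>* \<and> (b, d) \<in> (adj Q)\<^sup>*)"
    using rtrancl_mono[OF sub] * by blast
next
  assume *: "(c, d) \<in> (adj Q)\<^sup>* \<and> \<not> ((c, b) \<in> (adj Q)\<^sup>* \<and> (b, d) \<in> (adj Q)\<^sup>*)"
  then have "(c, d) \<in> (adj Q)\<^sup>*" and "\<not> ((c, b) \<in> (adj Q)\<^sup>* \<and> (b, d) \<in> (adj Q)\<^sup>*)"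
    by blast+
  then show "(c, d) \<in> (adj (Q - {b}))\<^sup>*"
  proof (induction rule: rtrancl_induct)
    case (step d e)
    have "\<not> ((c, b) \<in> (adj Q)\<^sup>* \<and> (b, d) \<in> (adj Q)\<^sup>*)"
      using step by (meson rtrancl.rtrancl_into_rtrancl)
    then have "(c, d) \<in> (adj (Q - {b}))\<^sup>*"
      by (rule step.IH)
    moreover have "d \<noteq> b" "e \<noteq> b"
      using step by (auto intro: rtrancl_into_rtrancl)
    with step(2) have "(d, e) \<in> adj (Q - {b})"
      by (auto simp: adj_def)
    ultimately show ?case
      by (rule rtrancl_into_rtrancl)
  qed simp
qed

lemma chain_rel_remove:
  assumes "b \<in> Q" "c \<in> Q - {b}"
  shows "chain_rel (Q - {b}) `` {c} =
    (if (c, b) \<in> (adj Q)\<^sup>* then {d \<in> Q - {b}. (d, b) \<in> (adj Q)\<^sup>*}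
     else if (b, c) \<in> (adj Q)\<^sup>* then {d \<in> Q - {b}. (b, d) \<in> (adj Q)\<^sup>*}
     else chain_rel Q `` {c})"
proof -
  have mem: "d \<in> chain_rel (Q - {b}) `` {c} \<longleftrightarrow> d \<in> Q - {b} \<and>
     ((c, d) \<in> (adj Q)\<^sup>* \<and> \<not> ((c, b) \<in> (adj Q)\<^sup>* \<and> (b, d) \<in> (adj Q)\<^sup>*) \<or>
      (d, c) \<in> (adj Q)\<^sup>* \<and> \<not> ((d, b) \<in> (adj Q)\<^sup>* \<and> (b, c) \<in> (adj Q)\<^sup>*))" for d
    unfolding chain_rel_class using assms adj_remove_iff[of c b d] adj_remove_iff[of d b c] by blast
  note [trans] = rtrancl_trans
  have cb: "c \<noteq> b" "c \<in> Q"
    using assms by auto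
  consider (before) "(c, b) \<in> (adj Q)\<^sup>*" "(b, c) \<notin> (adj Q)\<^sup>*"
    | (after) "(b, c) \<in> (adj Q)\<^sup>*" "(c, b) \<notin> (adj Q)\<^sup>*"
    | (other) "(b, c) \<notin> (adj Q)\<^sup>*" "(c, b) \<notin> (adj Q)\<^sup>*"
    using adj_rtrancl_antisym cb by blast
  then show ?thesis
  proof cases
    case before
    have "d \<in> chain_rel (Q - {b}) `` {c} \<longleftrightarrow> d \<in> Q - {b} \<and> (d, b) \<in> (adj Q)\<^sup>*" for d
      unfolding mem using before adj_forward[of c d b] adj_backward[of d b c] adj_rtrancl_antisym[of d b]
        rtrancl_trans[of d c "adj Q" b] by blast
    then show ?thesis
      using before by auto
  next
    case after
    have "d \<in> chain_rel (Q - {b}) `` {c} \<longleftrightarrow> d \<in> Q - {b} \<and> (b, d) \<in> (adj Q)\<^sup>*" for d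
      unfolding mem using after adj_forward[of b d c] adj_backward[of d c b] adj_rtrancl_antisym[of d b]
        rtrancl_trans[of b c "adj Q" d] by blast
    then show ?thesis
      using after by auto
  next
    case other
    have "d \<in> chain_rel (Q - {b}) `` {c} \<longleftrightarrow> d \<in> chain_rel Q `` {c}" for d
      unfolding mem using other cb by (auto simp: chain_rel_class)
    then show ?thesis
      using other by auto
  qed
qed

lemma finite_family: "finite Q"
  by (rule finite_nc_partition(1)[OF Q U])

lemma chain_class_Min:
  assumes "b \<in> Q"
  shows "{d \<in> Q - {b}. (d, b) \<in> (adj Q)\<^sup>*} = {d \<in> chain_rel Q `` {b}. Min d < Min b}"
    and "{d \<in> Q - {b}. (b, d) \<in> (adj Q)\<^sup>*} = {d \<in> chain_rel Q `` {b}. Min b < Min d}"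
  using adj_rtrancl_Min[of _ b] adj_rtrancl_Min[of b] assms unfolding chain_rel_class
  by (auto dest: less_asym)

text \<open>Removing \<open>b\<close> cuts its chain into the blocks before and the blocks after \<open>b\<close>. Either part may be
  empty, and then it is no class; the corresponding factor is \<open>cat 0 = 1\<close>.\<close>

lemma chain_weight_remove:
  assumes "b \<in> Q"
  defines "C \<equiv> chain_rel Q `` {b}"
  shows "chain_weight (Q - {b}) =
    cat (card {d \<in> C. Min d < Min b}) * cat (card {d \<in> C. Min b < Min d}) *
    (\<Prod>D\<in>Q // chain_rel Q - {C}. cat (card D) :: 'k::field_char_0)"
proof -
  define L where "L = {d \<in> Q - {b}. (d, b) \<in> (adj Q)\<^sup>*}"
  define R where "R = {d \<in> Q - {b}. (b, d) \<in> (adj Q)\<^sup>*}"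
  define f where "f = (\<lambda>c. chain_rel (Q - {b}) `` {c})"
  have LR: "L \<inter> R = {}" "L \<union> R \<union> {b} = C" "L \<subseteq> Q" "R \<subseteq> Q" "b \<notin> L" "b \<notin> R"
    using adj_rtrancl_antisym[of b] assms(1) by (auto simp: L_def R_def C_def chain_rel_class)
  have fL: "f c = L" if "c \<in> L" for c
    using that chain_rel_remove[OF assms(1), of c] by (simp add: f_def L_def)
  have fR: "f c = R" if "c \<in> R" for c
    using that chain_rel_remove[OF assms(1), of c] adj_rtrancl_antisym[of b c] by (auto simp: f_def R_def)
  have fo: "f c = chain_rel Q `` {c}" if "c \<in> Q - C" for c
    using that chain_rel_remove[OF assms(1), of c] assms(1) unfolding f_def C_def chain_rel_class by auto
  have "Q - {b} = (Q - C) \<union> L \<union> R"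
    using LR by auto
  then have "f ` (Q - {b}) = f ` (Q - C) \<union> (f ` L \<union> f ` R)"
    by auto
  also have "f ` L = {L} - {{}}"
    using fL by (cases "L = {}") auto
  also have "f ` R = {R} - {{}}"
    using fR by (cases "R = {}") auto
  also have "f ` (Q - C) = (\<lambda>c. chain_rel Q `` {c}) ` (Q - C)"
    using fo by (intro image_cong refl)
  also have "\<dots> = Q // chain_rel Q - {C}"
  proof -
    have "chain_rel Q `` {c} = C \<longleftrightarrow> c \<in> C" if "c \<in> Q" for c
      using that equiv_class_eq_iff[OF equiv_chain_rel, of b c] assms(1) by (auto simp: C_def)
    then show ?thesis
      unfolding quotient_chain_rel by auto
  qed
  finally have quot: "(Q - {b}) // chain_rel (Q - {b}) = (Q // chain_rel Q - {C}) \<union> (({L} - {{}}) \<union> ({R} - {{}}))"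
    by (simp add: quotient_chain_rel f_def)
  have fin: "finite (Q // chain_rel Q)"
    using finite_family by (simp add: quotient_chain_rel)
  have CQ: "C \<in> Q // chain_rel Q"
    using assms(1) by (simp add: C_def quotientI)
  have dis: "D \<inter> C = {}" if "D \<in> Q // chain_rel Q - {C}" for D
    using that quotient_disj[OF equiv_chain_rel _ CQ] by auto
  have "chain_weight (Q - {b}) = (\<Prod>D\<in>Q // chain_rel Q - {C}. cat (card D)) *
      (\<Prod>D\<in>({L} - {{}}) \<union> ({R} - {{}}). cat (card D) :: 'k)"
    unfolding chain_weight_def quot
    by (rule prod.union_disjoint) (use fin dis LR in blast)+
  also have "(\<Prod>D\<in>({L} - {{}}) \<union> ({R} - {{}}). cat (card D) :: 'k) =
      (\<Prod>D\<in>{L} - {{}}. cat (card D)) * (\<Prod>D\<in>{R} - {{}}. cat (card D))"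
    by (rule prod.union_disjoint) (use LR in auto)
  also have "(\<Prod>D\<in>{L} - {{}}. cat (card D)) = (cat (card L) :: 'k)"
    by (cases "L = {}") auto
  also have "(\<Prod>D\<in>{R} - {{}}. cat (card D)) = (cat (card R) :: 'k)"
    by (cases "R = {}") auto
  finally show ?thesis
    unfolding C_def using chain_class_Min[OF assms(1)] by (simp add: L_def R_def mult_ac)
qed

text \<open>Only the factor of \<open>C\<close> changes when an element of \<open>C\<close> is removed, and the sum of the changed factors is
  the Catalan convolution.\<close>

lemma sum_chain_weight_remove:
  assumes "C \<in> Q // chain_rel Q"
  shows "(\<Sum>b\<in>C. chain_weight (Q - {b})) = (chain_weight Q :: 'k::field_char_0)"
proof -
  have CQ: "C \<subseteq> Q" "C \<noteq> {}"
    using in_quotient_imp_subset[OF equiv_chain_rel assms] in_quotient_imp_non_empty[OF equiv_chain_rel assms]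
    by auto
  have finC: "finite C"
    using CQ(1) finite_family finite_subset by blast
  define W where "W = (\<Prod>D\<in>Q // chain_rel Q - {C}. cat (card D) :: 'k)"
  have inj: "inj_on Min C"
    using CQ(1) block_eq block_Min_Max(1) by (intro inj_onI) (metis subsetD)
  have card_eq: "card {d \<in> C. P (Min d)} = card {y \<in> Min ` C. P y}" for P
  proof -
    have "{y \<in> Min ` C. P y} = Min ` {d \<in> C. P (Min d)}"
      by auto
    then show ?thesis
      using inj by (simp add: card_image inj_on_subset)
  qed
  have "(\<Sum>b\<in>C. chain_weight (Q - {b})) =
     (\<Sum>b\<in>C. cat (card {y \<in> Min ` C. y < Min b}) * cat (card {y \<in> Min ` C. Min b < y}) * W)"
  proof (rule sum.cong)
    fix b assume "b \<in> C"
    obtain a where a: "C = chain_rel Q `` {a}"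
      using assms by (rule quotientE)
    then have "(a, b) \<in> chain_rel Q"
      using \<open>b \<in> C\<close> by simp
    then have b: "b \<in> Q" "chain_rel Q `` {b} = C"
      unfolding a using equiv_class_eq[OF equiv_chain_rel, of a b] by (simp_all add: chain_rel_def)
    show "chain_weight (Q - {b}) =
        cat (card {y \<in> Min ` C. y < Min b}) * cat (card {y \<in> Min ` C. Min b < y}) * W"
      using chain_weight_remove[OF b(1), where 'k = 'k]
        card_eq[of "\<lambda>y. y < Min b"] card_eq[of "\<lambda>y. Min b < y"]
      unfolding b(2) W_def by simp
  qed simp
  also have "\<dots> = (\<Sum>x\<in>Min ` C. cat (card {y \<in> Min ` C. y < x}) * cat (card {y \<in> Min ` C. x < y})) * W"
    by (simp add: sum_distrib_right sum.reindex[OF inj])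
  also have "\<dots> = cat (card (Min ` C)) * W"
    using finC CQ(2) by (subst sum_cat_ranks) auto
  also have "card (Min ` C) = card C"
    using inj by (rule card_image)
  also have "cat (card C) * W = chain_weight Q"
    unfolding chain_weight_def W_def using assms finite_family
    by (intro prod.remove[symmetric]) (auto simp: quotient_chain_rel)
  finally show ?thesis .
qed

text \<open>If no step of adjacency enters or leaves \<open>Q'\<close>, then neither does a chain.\<close>

lemma chain_class_closed_subset:
  assumes "Q' \<subseteq> Q" "\<And>c d. (c, d) \<in> adj Q \<Longrightarrow> c \<in> Q' \<longleftrightarrow> d \<in> Q'" "c \<in> Q'"
  shows "chain_rel Q' `` {c} = chain_rel Q `` {c}"
proof -
  have sub: "adj Q' \<subseteq> adj Q"
    using assms(1) by (auto simp: adj_def)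
  have fwd: "(c, d) \<in> (adj Q')\<^sup>* \<and> d \<in> Q'" if "(c, d) \<in> (adj Q)\<^sup>*" for d
    using that
  proof (induction rule: rtrancl_induct)
    case (step d e)
    then have "(d, e) \<in> adj Q'"
      using assms(2) by (auto simp: adj_def)
    with step show ?case
      using assms(2) by (meson rtrancl_into_rtrancl)
  qed (simp add: assms)
  have bwd: "(d, c) \<in> (adj Q')\<^sup>* \<and> d \<in> Q'" if "(d, c) \<in> (adj Q)\<^sup>*" for d
    using that
  proof (induction rule: converse_rtrancl_induct)
    case (step d e)
    then have "(d, e) \<in> adj Q'"
      using assms(2) by (auto simp: adj_def)
    with step show ?case
      using assms(2) by (meson converse_rtrancl_into_rtrancl)
  qed (simp add: assms)
  show ?thesis
    unfolding chain_rel_class using assms(1,3) fwd bwd rtrancl_mono[OF sub] by blast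
qed

text \<open>If \<open>b\<close> is followed by an adjacent block, then \<open>Max b\<close> and \<open>Max b + 1\<close> both belong to \<open>U\<close> and thus to the
  same maximal interval. So no chain leaves its interval, and the classes can be collected
  interval by interval.\<close>

lemma chain_weight_intervals:
  assumes "\<And>b. b \<in> Q \<Longrightarrow> \<exists>I\<in>intervals_of U. b \<subseteq> I"
  shows "chain_weight Q = (\<Prod>I\<in>intervals_of U. chain_weight {b \<in> Q. b \<subseteq> I} :: 'k::field_char_0)"
proof -
  define P where "P = (\<lambda>I. {b \<in> Q. b \<subseteq> I})"
  have PQ: "P I \<subseteq> Q" for I
    by (auto simp: P_def)
  have eq_I: "I = I'" if "b \<in> Q" "b \<inter> I \<noteq> {}" "b \<subseteq> I'" "I \<in> intervals_of U" "I' \<in> intervals_of U" for b I I'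
    using intervals_of_disjoint[OF U that(4,5)] that by blast
  have sub_I: "b \<subseteq> I" if "b \<in> Q" "b \<inter> I \<noteq> {}" "I \<in> intervals_of U" for b I
    using assms[OF that(1)] eq_I[OF that(1,2) _ that(3)] by blast
  have U_eq: "\<Union>Q = U"
    using Q by (simp add: nc_partitionsD(1))
  have closed: "c \<in> P I \<longleftrightarrow> d \<in> P I" if "I \<in> intervals_of U" "(c, d) \<in> adj Q" for I c d
  proof -
    have cd: "c \<in> Q" "d \<in> Q" "Max c + 1 = Min d"
      using that by (auto simp: adj_def)
    note m = block_Min_Max[OF cd(1)] block_Min_Max[OF cd(2)]
    obtain I' where I': "I' \<in> intervals_of U" "c \<subseteq> I'"
      using assms cd by blast
    have "Max c + 1 \<in> I'"
      using intervals_of_Suc[OF U I'(1), of "Max c"] m cd I'(2) U_eq by auto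
    then have "d \<subseteq> I'"
      using sub_I[OF cd(2) _ I'(1)] m cd(3) by auto
    then show ?thesis
      using eq_I[OF cd(1) _ _ that(1) I'(1)] eq_I[OF cd(2) _ _ that(1) I'(1)] I' m cd unfolding P_def by blast
  qed
  have PI: "P I // chain_rel (P I) = (\<lambda>c. chain_rel Q `` {c}) ` P I" if "I \<in> intervals_of U" for I
    unfolding quotient_chain_rel
    using chain_class_closed_subset[OF PQ closed[OF that]] by (intro image_cong refl)
  have "Q = (\<Union>I\<in>intervals_of U. P I)"
    using assms by (auto simp: P_def)
  then have "Q // chain_rel Q = (\<lambda>c. chain_rel Q `` {c}) ` (\<Union>I\<in>intervals_of U. P I)"
    by (simp add: quotient_chain_rel)
  also have "\<dots> = (\<Union>I\<in>intervals_of U. (P I // chain_rel (P I)))"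
    using PI by auto
  finally have quot: "Q // chain_rel Q = (\<Union>I\<in>intervals_of U. (P I // chain_rel (P I)))" .
  have sub: "C \<subseteq> P I" "C \<noteq> {}" if "C \<in> P I // chain_rel (P I)" for C I
    using that by (auto simp: quotient_def chain_rel_def)
  have "b \<notin> P I'" if "I \<in> intervals_of U" "I' \<in> intervals_of U" "I \<noteq> I'" "b \<in> P I" for I I' b
  proof
    assume "b \<in> P I'"
    then have "b \<in> Q" "b \<subseteq> I'" "b \<inter> I \<noteq> {}"
      using that(4) block_Min_Max(1)[of b] unfolding P_def by blast+
    then show False
      using eq_I that(1-3) by blast
  qed
  then have sep: "P I \<inter> P I' = {}" if "I \<in> intervals_of U" "I' \<in> intervals_of U" "I \<noteq> I'" for I I'
    using that by (meson disjoint_iff)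
  have dis: "(P I // chain_rel (P I)) \<inter> (P I' // chain_rel (P I')) = {}"
    if "I \<in> intervals_of U" "I' \<in> intervals_of U" "I \<noteq> I'" for I I'
  proof (rule ccontr)
    assume "(P I // chain_rel (P I)) \<inter> (P I' // chain_rel (P I')) \<noteq> {}"
    then obtain C where C: "C \<in> P I // chain_rel (P I)" "C \<in> P I' // chain_rel (P I')"
      by blast
    then have "C \<subseteq> P I \<inter> P I'" "C \<noteq> {}"
      using sub(1)[OF C(1)] sub(1)[OF C(2)] sub(2)[OF C(1)] by simp_all
    then show False
      using sep[OF that] by simp
  qed
  have fin: "finite (P I // chain_rel (P I))" for I
    using finite_subset[OF PQ finite_family] by (simp add: quotient_chain_rel)
  have "chain_weight Q = (\<Prod>I\<in>intervals_of U. chain_weight (P I) :: 'k)"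
    unfolding chain_weight_def quot
    by (intro prod.UNION_disjoint finite_intervals_of[OF U] ballI impI fin dis)
  then show ?thesis
    by (simp add: P_def)
qed

end

lemma rtrancl_image:
  assumes "\<And>x y. (x, y) \<in> r \<Longrightarrow> (f x, f y) \<in> s" "(x, y) \<in> r\<^sup>*"
  shows "(f x, f y) \<in> s\<^sup>*"
  using assms(2) by (induction rule: rtrancl_induct) (auto intro: assms(1) rtrancl_into_rtrancl)

lemma chain_weight_image:
  assumes inj: "inj_on f Q" and adj: "\<And>b c. b \<in> Q \<Longrightarrow> c \<in> Q \<Longrightarrow> Max (f b) + 1 = Min (f c) \<longleftrightarrow> Max b + 1 = Min c"
  shows "chain_weight (f ` Q) = (chain_weight Q :: 'k::field_char_0)"
proof -
  define g where "g = the_inv_into Q f"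
  have g: "g (f b) = b" if "b \<in> Q" for b
    using that inj by (simp add: g_def the_inv_into_f_f)
  have fwd: "(f b, f c) \<in> (adj (f ` Q))\<^sup>*" if "(b, c) \<in> (adj Q)\<^sup>*" for b c
    by (rule rtrancl_image[OF _ that]) (use adj in \<open>auto simp: adj_def\<close>)
  have bwd: "(g b, g c) \<in> (adj Q)\<^sup>*" if "(b, c) \<in> (adj (f ` Q))\<^sup>*" for b c
    by (rule rtrancl_image[OF _ that]) (use adj g in \<open>auto simp: adj_def\<close>)
  have iff: "(f b, f c) \<in> (adj (f ` Q))\<^sup>* \<longleftrightarrow> (b, c) \<in> (adj Q)\<^sup>*" if "b \<in> Q" "c \<in> Q" for b c
    using fwd[of b c] bwd[of "f b" "f c"] g[OF that(1)] g[OF that(2)] by auto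
  have cls: "chain_rel (f ` Q) `` {f b} = f ` (chain_rel Q `` {b})" if "b \<in> Q" for b
  proof (rule set_eqI)
    fix d
    show "d \<in> chain_rel (f ` Q) `` {f b} \<longleftrightarrow> d \<in> f ` (chain_rel Q `` {b})"
      unfolding chain_rel_class using iff[OF that] iff[OF _ that] that by blast
  qed
  have "f ` Q // chain_rel (f ` Q) = (`) f ` (Q // chain_rel Q)"
    unfolding quotient_chain_rel image_image using cls by (intro image_cong refl)
  moreover have sub: "C \<subseteq> Q" if "C \<in> Q // chain_rel Q" for C
    using that unfolding quotient_def chain_rel_def by blast
  moreover have "inj_on ((`) f) (Q // chain_rel Q)"
    using inj sub by (intro inj_onI) (metis inj_on_image_eq_iff)
  moreover have "card (f ` C) = card C" if "C \<in> Q // chain_rel Q" for C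
    using inj_on_subset[OF inj sub[OF that]] by (rule card_image)
  ultimately show ?thesis
    unfolding chain_weight_def by (simp add: prod.reindex)
qed

text \<open>Renumbering an interval is a translation and preserves adjacency. For a set with gaps this would be
  false: closing a gap creates new adjacent pairs.\<close>

lemma chain_weight_standardize:
  assumes P: "P \<in> nc_partitions I" and I: "is_interval_nat I"
  shows "chain_weight (standardize P) = (chain_weight P :: 'k::field_char_0)"
proof -
  obtain a b where ab: "a \<le> b" "I = {a..b}"
    using I by (auto simp: is_interval_nat_def)
  have fin: "finite I"
    using ab by simp
  have mono: "mono (rank I)"
    unfolding rank_def using fin by (intro monoI card_mono) auto
  have "Max (rank I ` c) + 1 = Min (rank I ` d) \<longleftrightarrow> Max c + 1 = Min d" if "c \<in> P" "d \<in> P" for c d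
  proof -
    have "finite c" "c \<noteq> {}" "finite d" "d \<noteq> {}"
      using that finite_nc_partition(2)[OF P fin] nc_partitionsD(2)[OF P] by auto
    then have eq: "Max (rank I ` c) = rank I (Max c)" "Min (rank I ` d) = rank I (Min d)"
      by (simp_all add: mono_Max_commute[OF mono] mono_Min_commute[OF mono])
    have "Max c \<in> I" "Min d \<in> I"
      using block_Min_Max[OF P fin] that nc_partitionsD(1)[OF P] by blast+
    then show ?thesis
      unfolding eq by (auto simp: ab(2) rank_interval)
  qed
  then have "chain_weight ((`) (rank I) ` P) = (chain_weight P :: 'k)"
    by (intro chain_weight_image inj_on_image_rank[OF P fin]) auto
  then show ?thesis
    using nc_partitionsD(1)[OF P] by (simp add: standardize_rank)
qed

section \<open>Outer blocks\<close>

text \<open>The minimal elements of the nesting order. Removing one of them leaves an ideal.\<close>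

definition outer :: "nat set set \<Rightarrow> nat set set" where
  "outer P = {b \<in> P. \<forall>c\<in>P. b \<subseteq> {Min c..Max c} \<longrightarrow> c = b}"

text \<open>A point of \<open>b\<close> outside the hull of \<open>c\<close>, the point \<open>x\<close>, and the two ends of \<open>c\<close> would form a
  crossing.\<close>

lemma nested_in_hull:
  assumes P: "P \<in> nc_partitions U" and U: "finite U" and bc: "b \<in> P" "c \<in> P" "b \<noteq> c"
    and x: "x \<in> b" "Min c < x" "x < Max c"
  shows "b \<subseteq> {Min c..Max c}"
proof
  fix y assume y: "y \<in> b"
  note c = block_Min_Max[OF P U bc(2)]
  note cross = nc_partitionsD(4)[OF P]
  have "y \<noteq> Min c" "y \<noteq> Max c"
    using block_eq[OF P U bc(1,2)] y c bc(3) by auto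
  moreover have "\<not> y < Min c"
    using cross[OF bc(1,2) y x(1) c(1,2)] x(2,3) bc(3) by auto
  moreover have "\<not> Max c < y"
    using cross[OF bc(2,1) c(1,2) x(1) y] x(2,3) bc(3) by auto
  ultimately show "y \<in> {Min c..Max c}"
    by auto
qed

text \<open>By disjointness, a block \<open>d\<close> whose hull properly encloses one of two adjacent blocks has an end point of
  the other strictly inside its hull, so the other block is nested in \<open>d\<close> as well.\<close>

lemma outer_adj_iff:
  assumes P: "P \<in> nc_partitions U" and U: "finite U" and bc: "(b, c) \<in> adj P"
  shows "b \<in> outer P \<longleftrightarrow> c \<in> outer P"
proof -
  have in_P: "b \<in> P" "c \<in> P" and succ: "Max b + 1 = Min c"
    using bc by (auto simp: adj_def)
  note m = block_Min_Max[OF P U]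
  note mb = m[OF in_P(1)] and mc = m[OF in_P(2)]
  have ne: "b \<noteq> c"
    using mb(3) succ by auto
  have cov_c: "d = c" if outer: "b \<in> outer P" and d: "d \<in> P" "c \<subseteq> {Min d..Max d}" for d
  proof (rule ccontr)
    assume "d \<noteq> c"
    note md = m[OF d(1)]
    have "Min d \<le> Min c" "Max c \<le> Max d"
      using d(2) mc by auto
    moreover have "Min d \<noteq> Min c" "Max d \<noteq> Max b \<or> d = b"
      using block_eq[OF P U d(1) in_P(2)] block_eq[OF P U d(1) in_P(1)] md mc mb \<open>d \<noteq> c\<close> by metis+
    moreover have "d \<noteq> b"
      using \<open>Max c \<le> Max d\<close> mc succ by auto
    moreover have "Min d \<noteq> Max b"
      using block_eq[OF P U d(1) in_P(1)] md mb \<open>d \<noteq> b\<close> by metis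
    ultimately have "b \<subseteq> {Min d..Max d}"
      using nested_in_hull[OF P U in_P(1) d(1), of "Max b"] mb mc succ by auto
    then show False
      using outer d(1) \<open>d \<noteq> b\<close> by (auto simp: outer_def)
  qed
  have cov_b: "d = b" if outer: "c \<in> outer P" and d: "d \<in> P" "b \<subseteq> {Min d..Max d}" for d
  proof (rule ccontr)
    assume "d \<noteq> b"
    note md = m[OF d(1)]
    have "Min d \<le> Min b" "Max b \<le> Max d"
      using d(2) mb by auto
    moreover have "Max d \<noteq> Max b"
      using block_eq[OF P U d(1) in_P(1)] md mb \<open>d \<noteq> b\<close> by metis
    moreover have "d \<noteq> c"
      using \<open>Min d \<le> Min b\<close> mb succ by auto
    moreover have "Max d \<noteq> Min c"
      using block_eq[OF P U d(1) in_P(2)] md mc \<open>d \<noteq> c\<close> by metis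
    ultimately have "c \<subseteq> {Min d..Max d}"
      using nested_in_hull[OF P U in_P(2) d(1), of "Min c"] mb mc succ by auto
    then show False
      using outer d(1) \<open>d \<noteq> c\<close> by (auto simp: outer_def)
  qed
  show ?thesis
    using cov_b cov_c in_P unfolding outer_def by blast
qed

text \<open>The class is that of the block \<open>a\<close> that contains the left end \<open>l\<close> of \<open>I\<close>, which is outer. Being
  outer passes along adjacency, so the whole class is outer. Conversely, the point left
  of an outer block other than \<open>a\<close> must be the last point of another outer block, and walking
  left in this way ends at \<open>a\<close>.\<close>

lemma outer_chain_class:
  assumes P: "P \<in> nc_partitions I" and I: "is_interval_nat I"
  shows "outer P \<in> P // chain_rel P"
proof -
  obtain l r where lr: "l \<le> r" "I = {l..r}"
    using I by (auto simp: is_interval_nat_def)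
  have fin: "finite I"
    using lr by simp
  note m = block_Min_Max[OF P fin] and un = nc_partitionsD(1)[OF P]
  have "l \<in> \<Union>P"
    using lr un by simp
  then obtain a where a: "a \<in> P" "l \<in> a"
    by blast
  have lower: "l \<le> Min b" if "b \<in> P" for b
    using m(1)[OF that] that un lr by auto
  have "a \<in> outer P"
  proof -
    have "c = a" if "c \<in> P" "a \<subseteq> {Min c..Max c}" for c
    proof -
      have "Min c = l"
        using lower[OF that(1)] a that by force
      then show ?thesis
        using block_eq[OF P fin that(1) a(1)] m(1)[OF that(1)] a(2) by metis
    qed
    then show ?thesis
      using a(1) by (auto simp: outer_def)
  qed
  moreover have "(a, b) \<in> (adj P)\<^sup>*" if "b \<in> outer P" for b
    using that
  proof (induction "Min b" arbitrary: b rule: less_induct)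
    case less
    then have b: "b \<in> P" "\<And>c. c \<in> P \<Longrightarrow> b \<subseteq> {Min c..Max c} \<Longrightarrow> c = b"
      by (auto simp: outer_def)
    show ?case
    proof (cases "Min b = l")
      case True
      then have "b = a"
        using block_eq[OF P fin b(1) a(1)] m(1)[OF b(1)] a(2) by metis
      then show ?thesis by simp
    next
      case False
      then have gt: "l < Min b"
        using lower[OF b(1)] by simp
      have "Min b \<le> r"
        using m(1)[OF b(1)] b(1) un lr by auto
      then have "Min b - 1 \<in> \<Union>P"
        using un lr gt by auto
      then obtain c where c: "c \<in> P" "Min b - 1 \<in> c"
        by blast
      have ne: "c \<noteq> b"
        using subsetD[OF m(4)[OF b(1)], of "Min b - 1"] c(2) gt by auto
      have Min_c: "Min c \<le> Min b - 1" and Max_c: "Min b - 1 \<le> Max c"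
        using subsetD[OF m(4)[OF c(1)] c(2)] by auto
      \<comment> \<open>A block reaching over the left end of \<open>b\<close> would contain \<open>b\<close> in its hull.\<close>
      have "Max c \<noteq> Min b"
        using block_eq[OF P fin c(1) b(1)] m(2)[OF c(1)] m(1)[OF b(1)] ne by metis
      moreover have "\<not> Min b < Max c"
      proof
        assume "Min b < Max c"
        then have "b \<subseteq> {Min c..Max c}"
          using nested_in_hull[OF P fin b(1) c(1) _ m(1)[OF b(1)]] ne Min_c gt by auto
        then show False
          using b(2) c(1) ne by blast
      qed
      ultimately have "Max c + 1 = Min b"
        using Max_c gt by auto
      then have "(c, b) \<in> adj P"
        using b(1) c(1) by (simp add: adj_def)
      moreover from this have "c \<in> outer P"
        using outer_adj_iff[OF P fin] less.prems by blast
      moreover have "Min c < Min b"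
        using Min_c gt by simp
      ultimately show ?thesis
        using less.hyps by (meson rtrancl_into_rtrancl)
    qed
  qed
  moreover have "b \<in> outer P" if "(b, c) \<in> (adj P)\<^sup>*" "c \<in> outer P" for b c
    using that by (induction rule: converse_rtrancl_induct) (use outer_adj_iff[OF P fin] in blast)+
  moreover have "c \<in> outer P" if "(b, c) \<in> (adj P)\<^sup>*" "b \<in> outer P" for b c
    using that by (induction rule: rtrancl_induct) (use outer_adj_iff[OF P fin] in blast)+
  moreover have "outer P \<subseteq> P"
    by (auto simp: outer_def)
  ultimately have "outer P = chain_rel P `` {a}"
    unfolding chain_rel_class using a(1) by blast
  then show ?thesis
    using a(1) by (simp add: quotientI)
qed

section \<open>The character \<open>mu\<close>\<close>

text \<open>A block that meets the hull of \<open>b\<close> is nested in it, hence belongs to the ideal. So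
  \<open>\<Union>Y\<close> contains the whole interval from \<open>Min b\<close> to \<open>Max b\<close>.\<close>

lemma ideal_block_in_interval:
  assumes Y: "is_ideal \<pi> Y" and b: "b \<in> Y"
  shows "\<exists>I\<in>intervals_of (\<Union>Y). b \<subseteq> I"
proof -
  obtain n where P: "blocks \<pi> \<in> nc_partitions {1..n}"
    using blocks_in_nc_partitions by blast
  have sub: "Y \<subseteq> blocks \<pi>" and up: "\<And>b c. b \<in> Y \<Longrightarrow> c \<in> blocks \<pi> \<Longrightarrow> c \<subseteq> {Min b..Max b} \<Longrightarrow> c \<in> Y"
    using Y by (auto simp: is_ideal_def)
  have bP: "b \<in> blocks \<pi>"
    using b sub by blast
  note m = block_Min_Max[OF P finite_atLeastAtMost bP]
  note un = nc_partitionsD(1)[OF P]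
  have "{Min b..Max b} \<subseteq> \<Union>Y"
  proof
    fix y assume y: "y \<in> {Min b..Max b}"
    have "Min b \<in> {1..n}" "Max b \<in> {1..n}"
      using m un bP by blast+
    then have "y \<in> \<Union>(blocks \<pi>)"
      using y un by simp
    then obtain c where c: "c \<in> blocks \<pi>" "y \<in> c"
      by blast
    show "y \<in> \<Union>Y"
    proof (cases "c = b")
      case False
      have "y \<noteq> Min b" "y \<noteq> Max b"
        using block_eq[OF P finite_atLeastAtMost c(1) bP c(2)] m False by auto
      then have "c \<subseteq> {Min b..Max b}"
        using nested_in_hull[OF P finite_atLeastAtMost c(1) bP False c(2)] y by simp
      then show ?thesis
        using up[OF b c(1)] c(2) by blast
    qed (use b c in blast)
  qed
  moreover have "finite (\<Union>Y)"
    by (rule finite_subset[of _ "{1..n}"]) (use sub un in auto)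
  moreover have "is_interval_nat {Min b..Max b}"
    unfolding is_interval_nat_def using m(3) by blast
  ultimately obtain I where "I \<in> intervals_of (\<Union>Y)" "{Min b..Max b} \<subseteq> I"
    using intervals_of_ex by meson
  then show ?thesis
    using m(4) by blast
qed

lemma ideal_nc_partition:
  assumes "is_ideal \<pi> Y"
  shows "Y \<in> nc_partitions (\<Union>Y)" "finite (\<Union>Y)"
proof -
  obtain n where P: "blocks \<pi> \<in> nc_partitions {1..n}"
    using blocks_in_nc_partitions by blast
  have sub: "Y \<subseteq> blocks \<pi>"
    using assms by (simp add: is_ideal_def)
  then show "Y \<in> nc_partitions (\<Union>Y)"
    by (rule nc_partitions_subset[OF P])
  show "finite (\<Union>Y)"
    by (rule finite_subset[of _ "{1..n}"]) (use sub nc_partitionsD(1)[OF P] in auto)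
qed

lemma ideal_interval_part:
  assumes Y: "is_ideal \<pi> Y" and I: "I \<in> intervals_of (\<Union>Y)"
  shows "{b \<in> Y. b \<subseteq> I} \<in> nc_partitions I"
proof -
  have "\<Union>{b \<in> Y. b \<subseteq> I} = I"
  proof
    show "I \<subseteq> \<Union>{b \<in> Y. b \<subseteq> I}"
    proof
      fix x assume x: "x \<in> I"
      then obtain b where b: "b \<in> Y" "x \<in> b"
        using intervals_ofD(4)[OF I] by blast
      obtain I' where I': "I' \<in> intervals_of (\<Union>Y)" "b \<subseteq> I'"
        using ideal_block_in_interval[OF Y b(1)] by blast
      then have "I' = I"
        using intervals_of_disjoint[OF ideal_nc_partition(2)[OF Y] I'(1) I] x b by blast
      then show "x \<in> \<Union>{b \<in> Y. b \<subseteq> I}"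
        using b I' by blast
    qed
  qed auto
  then show ?thesis
    using nc_partitions_subset[OF ideal_nc_partition(1)[OF Y], of "{b \<in> Y. b \<subseteq> I}"] by auto
qed

lemma card_ideal_intervals:
  assumes Y: "is_ideal \<pi> Y"
  shows "card Y = (\<Sum>I\<in>intervals_of (\<Union>Y). card {b \<in> Y. b \<subseteq> I})"
proof -
  note nc = ideal_nc_partition[OF Y]
  have finY: "finite Y"
    by (rule finite_nc_partition(1)[OF nc])
  have "Y = (\<Union>I\<in>intervals_of (\<Union>Y). {b \<in> Y. b \<subseteq> I})"
    using ideal_block_in_interval[OF Y] by blast
  then have "card Y = card (\<Union>I\<in>intervals_of (\<Union>Y). {b \<in> Y. b \<subseteq> I})"
    by (rule arg_cong)
  also have "\<dots> = (\<Sum>I\<in>intervals_of (\<Union>Y). card {b \<in> Y. b \<subseteq> I})"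
  proof (rule card_UN_disjoint)
    show "\<forall>I\<in>intervals_of (\<Union>Y). \<forall>I'\<in>intervals_of (\<Union>Y). I \<noteq> I' \<longrightarrow>
        {b \<in> Y. b \<subseteq> I} \<inter> {b \<in> Y. b \<subseteq> I'} = {}"
    proof (intro ballI impI)
      fix I I' assume *: "I \<in> intervals_of (\<Union>Y)" "I' \<in> intervals_of (\<Union>Y)" "I \<noteq> I'"
      have "b = {}" if "b \<subseteq> I" "b \<subseteq> I'" for b
        using intervals_of_disjoint[OF nc(2) *] that by blast
      then show "{b \<in> Y. b \<subseteq> I} \<inter> {b \<in> Y. b \<subseteq> I'} = {}"
        using nc_partitionsD(2)[OF nc(1)] by blast
    qed
  qed (use finite_intervals_of[OF nc(2)] finY in auto)
  finally show ?thesis .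
qed

lemma blocks_nonempty: "blocks \<pi> \<noteq> {}"
proof -
  obtain n where "n \<ge> 1" "blocks \<pi> \<in> nc_partitions {1..n}"
    using blocks_in_nc_partitions by blast
  then show ?thesis
    using nc_partitionsD(1)[of "blocks \<pi>" "{1..n}"] by auto
qed

lemma restriction_blocks: "restriction (blocks \<pi>) = gen \<pi>"
proof -
  obtain n where P: "blocks \<pi> \<in> nc_partitions {1..n}"
    using blocks_in_nc_partitions by blast
  have "(`) (rank {1..n}) b = id b" if "b \<in> blocks \<pi>" for b
  proof -
    have "rank {1..n} x = x" if "x \<in> b" for x
    proof -
      have "x \<in> {1..n}"
        using that \<open>b \<in> blocks \<pi>\<close> nc_partitionsD(1)[OF P] by blast
      then show ?thesis
        using rank_interval[of 1 x n] by simp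
    qed
    then show ?thesis
      by simp
  qed
  then have "(`) (rank {1..n}) ` blocks \<pi> = id ` blocks \<pi>"
    by (intro image_cong refl)
  then have "standardize (blocks \<pi>) = blocks \<pi>"
    using nc_partitionsD(1)[OF P] by (simp add: standardize_rank)
  then show ?thesis
    using blocks_nonempty by (simp add: restriction_def blocks_inverse)
qed

lemma dot_restriction_blocks: "dot_restriction (blocks \<pi>) = gen \<pi>"
proof -
  obtain n where P: "n \<ge> 1" "blocks \<pi> \<in> nc_partitions {1..n}"
    using blocks_in_nc_partitions by blast
  note un = nc_partitionsD(1)[OF P(2)]
  have "is_interval_nat {1..n}"
    unfolding is_interval_nat_def using P(1) by blast
  moreover have "{b \<in> blocks \<pi>. b \<subseteq> {1..n}} = blocks \<pi>"
    using un by blast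
  ultimately show ?thesis
    using restriction_blocks[of \<pi>] un by (simp add: dot_restriction_def intervals_of_interval)
qed

lemma blocks_standardize:
  assumes "Z \<in> nc_partitions U" "finite U" "Z \<noteq> {}"
  shows "blocks (Abs_ncp (standardize Z)) = standardize Z"
proof -
  have "U \<noteq> {}"
    using assms(1,3) nc_partitions_empty by auto
  with assms(1,2) show ?thesis
    by (intro blocks_Abs_ncp is_ncp_standardize_nc_partition)
qed

text \<open>These are the values of \<open>eps_delta\<close>; the empty family is included because its restriction is the unit.\<close>

lemma phi_restriction_at_1:
  assumes "is_phi \<phi>" "Z \<in> nc_partitions U" "finite U"
  shows "poly (\<phi> (restriction Z)) 1 = (if card Z \<le> 1 then 1 else 0)"
proof (cases "Z = {}")
  case False
  then have "card Z \<noteq> 0"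
    using finite_nc_partition(1)[OF assms(2,3)] by simp
  moreover have "card (blocks (Abs_ncp (standardize Z))) = card Z"
    using assms False by (simp add: blocks_standardize card_standardize)
  ultimately show ?thesis
    using False by (auto simp: restriction_def phi_at_1[OF assms(1)])
qed (simp add: restriction_def phi_one[OF assms(1)])

lemma outer_iff_ideal_complement: "b \<in> outer (blocks \<pi>) \<longleftrightarrow> b \<in> blocks \<pi> \<and> is_ideal \<pi> (blocks \<pi> - {b})"
  by (auto simp: outer_def is_ideal_def)

text \<open>Induction on the number of blocks, by \<open>eps_delta * mu = eps_Delta\<close>: this equation has the summand \<open>mu \<pi>\<close> for
  the ideal of all blocks and one summand for each outer block \<open>b\<close>. In the latter, \<open>mu\<close> is taken of the
  pieces of \<open>P - {b}\<close> on the maximal intervals, whose chain weights multiply to that of \<open>P - {b}\<close>.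
  Finally the outer blocks form one chain, so \<open>sum_chain_weight_remove\<close> adds these up to the
  chain weight of \<open>P\<close>.\<close>

lemma mu_gen:
  fixes \<phi> :: "'k::field_char_0 ncp_alg \<Rightarrow> 'k poly"
  assumes phi: "is_phi \<phi>"
  shows "mu \<phi> (gen \<pi>) = (- 1) ^ card (blocks \<pi>) * chain_weight (blocks \<pi>)"
proof (induction "card (blocks \<pi>)" arbitrary: \<pi> rule: less_induct)
  case less
  define P where "P = blocks \<pi>"
  obtain n where n: "n \<ge> 1" "P \<in> nc_partitions {1..n}"
    using blocks_in_nc_partitions unfolding P_def by blast
  have finP: "finite P"
    by (simp add: P_def finite_blocks)
  have int: "is_interval_nat {1..n}"
    unfolding is_interval_nat_def using n(1) by blast
  define g where "g = (\<lambda>Y. poly (\<phi> (dot_restriction Y)) (- 1))"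
  have outer_sub: "outer P \<subseteq> P"
    by (auto simp: outer_def)
  \<comment> \<open>The support of \<open>eps_delta\<close>, evaluated on the complement of the ideal.\<close>
  have ideals: "{Y. is_ideal \<pi> Y \<and> card (P - Y) \<le> 1} = insert P ((\<lambda>b. P - {b}) ` outer P)"
  proof (rule set_eqI, unfold mem_Collect_eq)
    fix Y
    show "is_ideal \<pi> Y \<and> card (P - Y) \<le> 1 \<longleftrightarrow> Y \<in> insert P ((\<lambda>b. P - {b}) ` outer P)"
    proof
      assume *: "is_ideal \<pi> Y \<and> card (P - Y) \<le> 1"
      then have "Y \<subseteq> P"
        by (simp add: is_ideal_def P_def)
      have "card (P - Y) = 0 \<or> card (P - Y) = 1"
        using * by linarith
      then show "Y \<in> insert P ((\<lambda>b. P - {b}) ` outer P)"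
      proof
        assume "card (P - Y) = 0"
        then have "Y = P"
          using \<open>Y \<subseteq> P\<close> finP by auto
        then show ?thesis by simp
      next
        assume "card (P - Y) = 1"
        then obtain b where b: "P - Y = {b}"
          by (rule card_1_singletonE)
        then have Y: "Y = P - {b}" "b \<in> P"
          using \<open>Y \<subseteq> P\<close> by auto
        then have "b \<in> outer P"
          using * outer_iff_ideal_complement[of b \<pi>] by (simp add: P_def)
        then show ?thesis
          using Y by blast
      qed
    next
      assume "Y \<in> insert P ((\<lambda>b. P - {b}) ` outer P)"
      then consider "Y = P" | b where "b \<in> outer P" "Y = P - {b}"
        by blast
      then show "is_ideal \<pi> Y \<and> card (P - Y) \<le> 1"
      proof cases
        case 1
        then show ?thesis by (simp add: is_ideal_def P_def)
      next
        case 2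
        then have "P - Y = {b}"
          using outer_sub by auto
        then show ?thesis
          using 2 outer_iff_ideal_complement[of b \<pi>] by (simp add: P_def)
      qed
    qed
  qed
  have "0 = (\<Sum>Y | is_ideal \<pi> Y. poly (\<phi> (restriction (P - Y))) 1 * g Y)"
    using phi_convolution[OF phi, of \<pi> 1 "- 1"] phi_zero[OF phi, of \<pi>] by (simp add: P_def g_def)
  also have "\<dots> = (\<Sum>Y | is_ideal \<pi> Y. (if card (P - Y) \<le> 1 then g Y else 0))"
  proof (rule sum.cong)
    fix Y
    have "P - Y \<in> nc_partitions (\<Union>(P - Y))"
      using n(2) by (rule nc_partitions_subset) blast
    moreover have "finite (\<Union>(P - Y))"
      by (rule finite_subset[of _ "{1..n}"]) (use nc_partitionsD(1)[OF n(2)] in auto)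
    ultimately show "poly (\<phi> (restriction (P - Y))) 1 * g Y = (if card (P - Y) \<le> 1 then g Y else 0)"
      using phi_restriction_at_1[OF phi] by simp
  qed simp
  also have "\<dots> = (\<Sum>Y\<in>insert P ((\<lambda>b. P - {b}) ` outer P). g Y)"
    unfolding ideals[symmetric] by (subst sum.If_cases) (auto simp: finite_ideals Int_def)
  also have "\<dots> = g P + (\<Sum>Y\<in>(\<lambda>b. P - {b}) ` outer P. g Y)"
    using finite_subset[OF outer_sub finP] outer_sub by (intro sum.insert) auto
  also have "(\<Sum>Y\<in>(\<lambda>b. P - {b}) ` outer P. g Y) = (\<Sum>b\<in>outer P. g (P - {b}))"
    using outer_sub by (subst sum.reindex) (auto intro!: inj_onI)
  also have "\<dots> = (\<Sum>b\<in>outer P. (- 1) ^ (card P - 1) * chain_weight (P - {b}))"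
  proof (rule sum.cong)
    fix b assume b: "b \<in> outer P"
    define Y where "Y = P - {b}"
    have Y: "is_ideal \<pi> Y"
      using b outer_iff_ideal_complement[of b \<pi>] by (simp add: Y_def P_def)
    have bP: "b \<in> P"
      using b outer_sub by blast
    note nc = ideal_nc_partition[OF Y]
    have finY: "finite Y"
      using finP by (simp add: Y_def)
    have part: "poly (\<phi> (restriction {b \<in> Y. b \<subseteq> I})) (- 1) =
        (- 1) ^ card {b \<in> Y. b \<subseteq> I} * chain_weight {b \<in> Y. b \<subseteq> I}" if I: "I \<in> intervals_of (\<Union>Y)" for I
    proof -
      define Z where "Z = {b \<in> Y. b \<subseteq> I}"
      have Z: "Z \<in> nc_partitions I"
        unfolding Z_def by (rule ideal_interval_part[OF Y I])
      note ID = intervals_ofD[OF I]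
      have "Z \<noteq> {}"
        using ID(2) nc_partitionsD(1)[OF Z] by auto
      then have blk: "blocks (Abs_ncp (standardize Z)) = standardize Z"
        by (rule blocks_standardize[OF Z ID(3)])
      have "card Z \<le> card Y"
        using finY by (intro card_mono) (auto simp: Z_def)
      also have "card Y < card P"
        unfolding Y_def using finP bP by (rule card_Diff1_less)
      finally have "card (blocks (Abs_ncp (standardize Z))) < card (blocks \<pi>)"
        using card_standardize[OF Z ID(3)] by (simp add: blk P_def)
      from less[OF this] have "mu \<phi> (gen (Abs_ncp (standardize Z))) = (- 1) ^ card Z * chain_weight Z"
        using card_standardize[OF Z ID(3)] chain_weight_standardize[OF Z ID(1), where 'k = 'k] by (simp add: blk)
      then show ?thesis
        using \<open>Z \<noteq> {}\<close> unfolding Z_def[symmetric] by (simp add: restriction_def mu_def)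
    qed
    have "g Y = (\<Prod>I\<in>intervals_of (\<Union>Y). (- 1) ^ card {b \<in> Y. b \<subseteq> I} * chain_weight {b \<in> Y. b \<subseteq> I})"
      unfolding g_def phi_dot_restriction[OF phi] using part by (rule prod.cong[OF refl])
    also have "\<dots> = (- 1) ^ card Y * (\<Prod>I\<in>intervals_of (\<Union>Y). chain_weight {b \<in> Y. b \<subseteq> I})"
      by (simp add: prod.distrib card_ideal_intervals[OF Y] power_sum)
    also have "(\<Prod>I\<in>intervals_of (\<Union>Y). chain_weight {b \<in> Y. b \<subseteq> I}) = (chain_weight Y :: 'k)"
      by (rule chain_weight_intervals[OF nc ideal_block_in_interval[OF Y], symmetric])
    also have "card Y = card P - 1"
      using finP bP by (simp add: Y_def)
    finally show "g (P - {b}) = (- 1) ^ (card P - 1) * chain_weight (P - {b})"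
      by (simp add: Y_def)
  qed simp
  also have "\<dots> = (- 1) ^ (card P - 1) * chain_weight P"
    using sum_chain_weight_remove[OF n(2) finite_atLeastAtMost outer_chain_class[OF n(2) int], where 'k = 'k]
    by (simp flip: sum_distrib_left)
  also have "g P = mu \<phi> (gen \<pi>)"
    by (simp add: g_def P_def dot_restriction_blocks mu_def)
  finally have "mu \<phi> (gen \<pi>) = - ((- 1) ^ (card P - 1) * chain_weight P)"
    by (simp add: eq_neg_iff_add_eq_0)
  moreover have "card P = Suc (card P - 1)"
    using finP blocks_nonempty by (simp add: P_def card_gt_0_iff)
  ultimately show ?case
    unfolding P_def[symmetric] by (metis mult_minus_left mult_minus1 power_Suc)
qed

section \<open>The antipode of the discrete partitions\<close>

lemma scale_alg_sum_left: "scale_alg (\<Sum>i\<in>A. c i) x = (\<Sum>i\<in>A. scale_alg (c i) x)"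
  by (induction A rule: infinite_finite_induct) (simp_all add: scale_alg_def single_add distrib_right)

lemma scale_alg_mult_left: "scale_alg c x * y = scale_alg c (x * y)"
  by (simp add: scale_alg_def mult.assoc)

text \<open>The character \<open>eps_delta\<close> is \<open>1\<close> on the product exactly if the part of \<open>Y\<close> over each maximal
  interval consists of one block, which is then the interval itself.\<close>

lemma phi_dot_restriction_at_1:
  assumes phi: "is_phi \<phi>" and Y: "is_ideal \<pi> Y"
  shows "poly (\<phi> (dot_restriction Y)) 1 = (if intervals_of (\<Union>Y) = Y then 1 else 0)"
proof -
  note nc = ideal_nc_partition[OF Y]
  have "poly (\<phi> (dot_restriction Y)) 1 =
      (\<Prod>I\<in>intervals_of (\<Union>Y). if card {b \<in> Y. b \<subseteq> I} \<le> 1 then 1 else 0)"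
    unfolding phi_dot_restriction[OF phi]
    using phi_restriction_at_1[OF phi ideal_interval_part[OF Y] intervals_ofD(3)]
    by (intro prod.cong refl) auto
  also have "\<dots> = (if \<forall>I\<in>intervals_of (\<Union>Y). card {b \<in> Y. b \<subseteq> I} \<le> 1 then 1 else 0)"
    using finite_intervals_of[OF nc(2)] by (auto intro!: prod.neutral prod_zero)
  also have "(\<forall>I\<in>intervals_of (\<Union>Y). card {b \<in> Y. b \<subseteq> I} \<le> 1) \<longleftrightarrow> intervals_of (\<Union>Y) = Y"
  proof
    assume *: "\<forall>I\<in>intervals_of (\<Union>Y). card {b \<in> Y. b \<subseteq> I} \<le> 1"
    have mem: "I \<in> Y" if I: "I \<in> intervals_of (\<Union>Y)" for I
    proof -
      note Z = ideal_interval_part[OF Y I] and ID = intervals_ofD[OF I]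
      have "finite {b \<in> Y. b \<subseteq> I}"
        by (rule finite_nc_partition(1)[OF Z ID(3)])
      moreover have "{b \<in> Y. b \<subseteq> I} \<noteq> {}"
        using nc_partitionsD(1)[OF Z] ID(2) by auto
      ultimately have "card {b \<in> Y. b \<subseteq> I} \<noteq> 0"
        by (simp only: card_eq_0_iff) blast
      moreover have "card {b \<in> Y. b \<subseteq> I} \<le> 1"
        using * I by blast
      ultimately have "card {b \<in> Y. b \<subseteq> I} = 1"
        by linarith
      then obtain c where c: "{b \<in> Y. b \<subseteq> I} = {c}"
        by (rule card_1_singletonE)
      then have "c = I"
        using nc_partitionsD(1)[OF Z] by simp
      then show ?thesis
        using c by blast
    qed
    have mem': "b \<in> intervals_of (\<Union>Y)" if b: "b \<in> Y" for b
    proof -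
      obtain I where I: "I \<in> intervals_of (\<Union>Y)" "b \<subseteq> I"
        using ideal_block_in_interval[OF Y b] by blast
      have "b \<noteq> {}"
        using nc_partitionsD(2)[OF nc(1)] b by blast
      then have "b \<inter> I \<noteq> {}"
        using I(2) by blast
      then have "b = I"
        using nc_partitionsD(3)[OF nc(1) b mem[OF I(1)]] by blast
      then show ?thesis
        using I(1) by simp
    qed
    show "intervals_of (\<Union>Y) = Y"
      by (rule subset_antisym; rule subsetI) (erule mem, erule mem')
  next
    assume *: "intervals_of (\<Union>Y) = Y"
    show "\<forall>I\<in>intervals_of (\<Union>Y). card {b \<in> Y. b \<subseteq> I} \<le> 1"
    proof
      fix I assume I: "I \<in> intervals_of (\<Union>Y)"
      have "b = I" if "b \<in> Y" "b \<subseteq> I" for b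
      proof (rule ccontr)
        assume "b \<noteq> I"
        moreover have bI: "b \<in> intervals_of (\<Union>Y)"
          using that(1) * by simp
        ultimately have "b \<inter> I = {}"
          by (intro intervals_of_disjoint[OF nc(2) _ I])
        then show False
          using that(2) intervals_ofD(2)[OF bI] by blast
      qed
      then have "{b \<in> Y. b \<subseteq> I} \<subseteq> {I}"
        by blast
      then show "card {b \<in> Y. b \<subseteq> I} \<le> 1"
        using card_mono[of "{I}"] by simp
    qed
  qed
  finally show ?thesis .
qed

text \<open>A block nested in an interval block is contained in it, hence equal to it.\<close>

lemma is_ideal_interval_family:
  assumes "K \<subseteq> blocks \<pi>" "intervals_of (\<Union>K) = K"
  shows "is_ideal \<pi> K"
  unfolding is_ideal_def
proof (intro conjI assms(1) ballI impI)
  fix b c assume b: "b \<in> K" and c: "c \<in> blocks \<pi>" "c \<subseteq> {Min b..Max b}"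
  obtain n where P: "blocks \<pi> \<in> nc_partitions {1..n}"
    using blocks_in_nc_partitions by blast
  have bI: "b \<in> intervals_of (\<Union>K)"
    using b assms(2) by simp
  have bP: "b \<in> blocks \<pi>"
    using b assms(1) by blast
  have "{Min b..Max b} \<subseteq> b"
    using intervals_ofD(5)[OF bI] block_Min_Max(1,2)[OF P finite_atLeastAtMost bP] by blast
  then have "c \<subseteq> b"
    using c(2) by blast
  then have "Min c \<in> c" "Min c \<in> b"
    using block_Min_Max(1)[OF P finite_atLeastAtMost c(1)] by blast+
  then have "c = b"
    by (rule block_eq[OF P finite_atLeastAtMost c(1) bP])
  then show "c \<in> K"
    using b by simp
qed

text \<open>This is \<open>(mu * eps_delta)(P) = 0\<close>, with the ideals on which \<open>eps_delta\<close> vanishes left out.\<close>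

lemma sum_mu_remove_intervals:
  assumes phi: "is_phi \<phi>" and P: "P \<in> nc_partitions {1..n}" "n \<ge> 1"
  shows "(\<Sum>K | K \<subseteq> P \<and> intervals_of (\<Union>K) = K. mu \<phi> (restriction (P - K))) = 0"
proof -
  define \<pi> where "\<pi> = Abs_ncp P"
  have "is_ncp P"
    using P is_ncp_iff by blast
  then have blk: "blocks \<pi> = P"
    by (simp add: \<pi>_def blocks_Abs_ncp)
  have "0 = (\<Sum>Y | is_ideal \<pi> Y. mu \<phi> (restriction (P - Y)) * poly (\<phi> (dot_restriction Y)) 1)"
    using phi_convolution[OF phi, of \<pi> "- 1" 1] phi_zero[OF phi, of \<pi>] by (simp add: blk mu_def)
  also have "\<dots> = (\<Sum>Y | is_ideal \<pi> Y. if intervals_of (\<Union>Y) = Y then mu \<phi> (restriction (P - Y)) else 0)"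
    by (intro sum.cong refl) (simp add: phi_dot_restriction_at_1[OF phi])
  also have "\<dots> = (\<Sum>Y | is_ideal \<pi> Y \<and> intervals_of (\<Union>Y) = Y. mu \<phi> (restriction (P - Y)))"
    by (subst sum.If_cases) (auto simp: finite_ideals Int_def)
  also have "{Y. is_ideal \<pi> Y \<and> intervals_of (\<Union>Y) = Y} = {K. K \<subseteq> P \<and> intervals_of (\<Union>K) = K}"
    using is_ideal_interval_family[of _ \<pi>] unfolding blk by (auto simp: is_ideal_def blk)
  finally show ?thesis
    by simp
qed

text \<open>The proposed antipode of \<open>J n\<close>, for \<open>n = card U\<close>, written as a sum over the partitions of the set \<open>U\<close>
  itself. The recursion needs it for the complements of the subsets of \<open>{1..n}\<close>.\<close>

definition antipode_sum :: "('k::field_char_0 ncp_alg \<Rightarrow> 'k poly) \<Rightarrow> nat set \<Rightarrow> 'k ncp_alg" where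
  "antipode_sum \<phi> U =
     (\<Sum>P\<in>nc_partitions U. scale_alg (mu \<phi> (restriction P)) (\<Prod>b\<in>P. J (card b)))"

lemma antipode_sum_eq:
  assumes "finite U" "U \<noteq> {}"
  shows "antipode_sum \<phi> U =
    (\<Sum>\<pi>\<in>NCP (card U). scale_alg (mu \<phi> (gen \<pi>)) (\<Prod>b\<in>blocks \<pi>. J (card b)))"
proof -
  define h where "h = (\<lambda>Q :: nat set set. scale_alg (mu \<phi> (gen (Abs_ncp Q))) (\<Prod>b\<in>Q. J (card b)))"
  have ne: "P \<noteq> {}" if "P \<in> nc_partitions U" for P
    using nc_partitionsD(1)[OF that] assms(2) by auto
  have "antipode_sum \<phi> U = (\<Sum>P\<in>nc_partitions U. h (standardize P))"
    unfolding antipode_sum_def h_def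
    by (intro sum.cong refl) (simp add: restriction_def ne prod_standardize[OF _ assms(1)])
  also have "\<dots> = (\<Sum>Q\<in>nc_partitions {1..card U}. h Q)"
    by (rule sum.reindex_bij_betw[OF bij_betw_standardize[OF assms(1)]])
  also have "\<dots> = (\<Sum>\<pi>\<in>NCP (card U). h (blocks \<pi>))"
    using assms by (intro sum.reindex_bij_betw[symmetric] bij_betw_blocks) (simp add: Suc_le_eq card_gt_0_iff)
  finally show ?thesis
    by (simp add: h_def blocks_inverse)
qed

lemma antipode_sum_empty:
  assumes "is_phi \<phi>"
  shows "antipode_sum \<phi> {} = 1"
  by (simp add: antipode_sum_def nc_partitions_empty restriction_def mu_def phi_one[OF assms] scale_alg_def)

text \<open>An interval crosses no set disjoint from it.\<close>

lemma nc_partitions_Un_intervals: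
  assumes U: "finite U" and A: "A \<subseteq> U" and P: "P \<in> nc_partitions (U - A)"
  shows "P \<union> intervals_of A \<in> nc_partitions U" "P \<inter> intervals_of A = {}"
proof -
  have finA: "finite A"
    using U A by (rule rev_finite_subset)
  note D = nc_partitionsD[OF P] and ID = intervals_ofD
  have PA: "b \<inter> A = {}" if "b \<in> P" for b
    using D(1) that by blast
  have apart: "b \<inter> I = {}" if "b \<in> P" "I \<in> intervals_of A" for b I
    using PA[OF that(1)] ID(4)[OF that(2)] by blast
  show dis: "P \<inter> intervals_of A = {}"
  proof (rule ccontr)
    assume "P \<inter> intervals_of A \<noteq> {}"
    then obtain b where "b \<in> P" "b \<in> intervals_of A"
      by blast
    then show False
      using apart[of b b] D(2) by auto
  qed
  have disj: "b \<inter> c = {}" if "b \<in> P \<union> intervals_of A" "c \<in> P \<union> intervals_of A" "b \<noteq> c" for b c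
    using that apart[of b c] apart[of c b] D(3)[of b c] intervals_of_disjoint[OF finA, of b c] by blast
  show "P \<union> intervals_of A \<in> nc_partitions U"
  proof (rule nc_partitionsI)
    show "\<Union>(P \<union> intervals_of A) = U"
      using D(1) Union_intervals_of[OF finA] A by auto
    show "{} \<notin> P \<union> intervals_of A"
      using D(2) ID(2) by blast
    fix b c assume b: "b \<in> P \<union> intervals_of A" "c \<in> P \<union> intervals_of A"
    then show "b \<inter> c = {}" if "b \<noteq> c"
      using that by (rule disj)
    fix x y z t assume *: "x \<in> b" "z \<in> b" "y \<in> c" "t \<in> c" "x < y" "y < z" "z < t"
    consider "b \<in> P" "c \<in> P" | "b \<in> intervals_of A" | "c \<in> intervals_of A"
      using b by blast
    then show "b = c"
    proof cases
      case 1
      then show ?thesis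
        using D(4)[OF _ _ *] by blast
    next
      case 2
      have "y \<in> b"
        using ID(5)[OF 2 *(1,2)] *(5,6) by auto
      then show ?thesis
        using disj[OF b] *(3) by blast
    next
      case 3
      have "z \<in> c"
        using ID(5)[OF 3 *(3,4)] *(6,7) by auto
      then show ?thesis
        using disj[OF b] *(2) by blast
    qed
  qed
qed

text \<open>The pairs of a set \<open>A\<close> and a noncrossing partition of its complement correspond to the pairs of a
  noncrossing partition \<open>P\<close> of \<open>{1..n}\<close> and a subset \<open>K\<close> of \<open>P\<close> that consists of the maximal intervals of
  \<open>\<Union>K\<close>. The monomial that occurs depends on \<open>P\<close> only, and its coefficient is the sum over \<open>K\<close> that
  \<open>sum_mu_remove_intervals\<close> shows to be zero.\<close>

lemma antipode_sum_recursion: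
  assumes phi: "is_phi \<phi>" and n: "n \<ge> 1"
  shows "(\<Sum>A\<in>Pow {1..n}. antipode_sum \<phi> ({1..n} - A) * (\<Prod>I\<in>intervals_of A. J (card I))) = 0"
proof -
  define U where "U = {1..n}"
  have finU: "finite U"
    by (simp add: U_def)
  define F where "F = (\<lambda>(P :: nat set set) (K :: nat set set). scale_alg (mu \<phi> (restriction P)) ((\<Prod>b\<in>P. J (card b)) * (\<Prod>b\<in>K. J (card b))))"
  have "(\<Sum>A\<in>Pow U. antipode_sum \<phi> (U - A) * (\<Prod>I\<in>intervals_of A. J (card I))) =
      (\<Sum>A\<in>Pow U. \<Sum>P\<in>nc_partitions (U - A). F P (intervals_of A))"
    by (simp add: antipode_sum_def F_def sum_distrib_right scale_alg_mult_left)
  also have "\<dots> = (\<Sum>(A, P)\<in>(SIGMA A:Pow U. nc_partitions (U - A)). F P (intervals_of A))"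
    using finU by (intro sum.Sigma) (auto intro: finite_nc_partitions)
  also have "\<dots> = (\<Sum>(P, K)\<in>(SIGMA P:nc_partitions U. {K. K \<subseteq> P \<and> intervals_of (\<Union>K) = K}). F (P - K) K)"
  \<comment> \<open>From \<open>K\<close> the set \<open>A\<close> is recovered as \<open>\<Union>K\<close>.\<close>
  proof (rule sum.reindex_bij_witness[of _ "\<lambda>(P, K). (\<Union>K, P - K)" "\<lambda>(A, P). (P \<union> intervals_of A, intervals_of A)"],
      goal_cases)
    case (1 x)
    then obtain A P where x: "x = (A, P)" "A \<subseteq> U" "P \<in> nc_partitions (U - A)"
      by auto
    have "finite A"
      using finU x(2) by (rule rev_finite_subset)
    then show ?case
      using nc_partitions_Un_intervals(2)[OF finU x(2,3)] x(1) by (auto simp: Union_intervals_of)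
  next
    case (2 x)
    then obtain A P where x: "x = (A, P)" "A \<subseteq> U" "P \<in> nc_partitions (U - A)"
      by auto
    have "finite A"
      using finU x(2) by (rule rev_finite_subset)
    then show ?case
      using nc_partitions_Un_intervals(1)[OF finU x(2,3)] x(1) by (auto simp: Union_intervals_of)
  next
    case (3 y)
    then show ?case by auto
  next
    case (4 y)
    then obtain P K where y: "y = (P, K)" "P \<in> nc_partitions U" "K \<subseteq> P" "intervals_of (\<Union>K) = K"
      by auto
    note D = nc_partitionsD[OF y(2)]
    have "b \<inter> c = {}" if "b \<in> P - K" "c \<in> K" for b c
      using D(3)[of b c] that y(3) by blast
    then have "\<Union>(P - K) = U - \<Union>K"
      using D(1) y(3) by blast
    moreover have "P - K \<in> nc_partitions (\<Union>(P - K))"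
      using y(2) by (rule nc_partitions_subset) blast
    ultimately have "P - K \<in> nc_partitions (U - \<Union>K)"
      by simp
    moreover have "\<Union>K \<subseteq> U"
      using D(1) y(3) by blast
    ultimately show ?case
      by (simp add: y(1))
  next
    case (5 x)
    then obtain A P where x: "x = (A, P)" "A \<subseteq> U" "P \<in> nc_partitions (U - A)"
      by auto
    have "P \<union> intervals_of A - intervals_of A = P"
      using nc_partitions_Un_intervals(2)[OF finU x(2,3)] by blast
    then show ?case
      by (simp add: x(1))
  qed
  also have "\<dots> = (\<Sum>P\<in>nc_partitions U. \<Sum>K | K \<subseteq> P \<and> intervals_of (\<Union>K) = K. F (P - K) K)"
  proof (intro sum.Sigma[symmetric] ballI)
    fix P assume "P \<in> nc_partitions U"
    then have "finite P"
      using finU by (rule finite_nc_partition(1))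
    then show "finite {K. K \<subseteq> P \<and> intervals_of (\<Union>K) = K}"
      by simp
  qed (rule finite_nc_partitions[OF finU])
  also have "\<dots> = (\<Sum>P\<in>nc_partitions U. 0)"
  proof (rule sum.cong)
    fix P assume P: "P \<in> nc_partitions U"
    have finP: "finite P"
      using P finU by (rule finite_nc_partition(1))
    have "F (P - K) K = scale_alg (mu \<phi> (restriction (P - K))) (\<Prod>b\<in>P. J (card b))" if "K \<subseteq> P" for K
      unfolding F_def prod.subset_diff[OF that finP] by (rule refl)
    then have "(\<Sum>K | K \<subseteq> P \<and> intervals_of (\<Union>K) = K. F (P - K) K) =
        scale_alg (\<Sum>K | K \<subseteq> P \<and> intervals_of (\<Union>K) = K. mu \<phi> (restriction (P - K))) (\<Prod>b\<in>P. J (card b))"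
      by (simp add: scale_alg_sum_left)
    also have "\<dots> = 0"
      using sum_mu_remove_intervals[OF phi _ n] P by (simp add: U_def scale_alg_def)
    finally show "(\<Sum>K | K \<subseteq> P \<and> intervals_of (\<Union>K) = K. F (P - K) K) = 0" .
  qed simp
  finally show ?thesis
    by (simp add: U_def)
qed

abbreviation singletons :: "nat set \<Rightarrow> nat set set" where
  "singletons A \<equiv> (\<lambda>i. {i}) ` A"

lemma blocks_discrete_ncp: "n \<ge> 1 \<Longrightarrow> blocks (discrete_ncp n) = singletons {1..n}"
  unfolding discrete_ncp_def by (intro blocks_Abs_ncp is_ncp_singletons)

lemma restriction_singletons:
  assumes "finite A"
  shows "restriction (singletons A) = (if A = {} then 1 else J (card A))"
  using standardize_singletons[OF assms] by (simp add: restriction_def J_def discrete_ncp_def)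

lemma dot_restriction_singletons:
  assumes "finite A"
  shows "dot_restriction (singletons A) = (\<Prod>I\<in>intervals_of A. J (card I))"
proof -
  have "restriction {b \<in> singletons A. b \<subseteq> I} = (J (card I) :: 'a ncp_alg)" if "I \<in> intervals_of A" for I
  proof -
    have "{b \<in> singletons A. b \<subseteq> I} = singletons I"
      using intervals_ofD(4)[OF that] by auto
    then show ?thesis
      using intervals_ofD(2,3)[OF that] by (simp add: restriction_singletons)
  qed
  then show ?thesis
    by (simp add: dot_restriction_def)
qed

text \<open>The ideals of the discrete partition are given by the subsets \<open>A\<close> of \<open>{1..n}\<close>, and
  both sides satisfy the same recursion. The summands with \<open>A \<noteq> {}\<close> agree by induction, so those with \<open>A = {}\<close> do too.\<close>

lemma antipode_J:
  fixes \<phi> :: "'k::field_char_0 ncp_alg \<Rightarrow> 'k poly"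
  assumes S: "is_antipode S" and phi: "is_phi \<phi>"
  shows "n \<ge> 1 \<Longrightarrow> S (J n) = antipode_sum \<phi> {1..n}"
proof (induction n rule: less_induct)
  case (less n)
  define D where "D = (\<lambda>A. \<Prod>I\<in>intervals_of A. J (card I) :: 'k ncp_alg)"
  have inj: "inj_on singletons (Pow {1..n})"
    by (rule inj_onI) auto
  have ideals: "{Y. is_ideal (discrete_ncp n) Y} = singletons ` Pow {1..n}"
  proof (rule set_eqI)
    fix Y
    show "Y \<in> {Y. is_ideal (discrete_ncp n) Y} \<longleftrightarrow> Y \<in> singletons ` Pow {1..n}"
      using less.prems by (auto simp: is_ideal_def blocks_discrete_ncp subset_image_iff)
  qed
  have "0 = (\<Sum>Y\<in>singletons ` Pow {1..n}. S (restriction (singletons {1..n} - Y)) * dot_restriction Y)"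
    using antipode_recursion[OF S, of "discrete_ncp n"] less.prems by (simp add: ideals blocks_discrete_ncp)
  also have "\<dots> = (\<Sum>A\<in>Pow {1..n}. S (restriction (singletons {1..n} - singletons A)) * dot_restriction (singletons A))"
    by (simp only: sum.reindex[OF inj] comp_def)
  also have "\<dots> = (\<Sum>A\<in>Pow {1..n}. S (restriction (singletons ({1..n} - A))) * D A)"
  proof (rule sum.cong)
    fix A assume "A \<in> Pow {1..n}"
    then have "finite A"
      by (auto intro: finite_subset)
    moreover have "singletons {1..n} - singletons A = singletons ({1..n} - A)"
      by auto
    ultimately show "S (restriction (singletons {1..n} - singletons A)) * dot_restriction (singletons A) =
        S (restriction (singletons ({1..n} - A))) * D A"
      by (simp add: dot_restriction_singletons D_def)
  qed simp
  also have "\<dots> = S (restriction (singletons {1..n})) + (\<Sum>A\<in>Pow {1..n} - {{}}. S (restriction (singletons ({1..n} - A))) * D A)"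
    by (subst sum.remove[of _ "{}"]) (simp_all add: D_def)
  also have "(\<Sum>A\<in>Pow {1..n} - {{}}. S (restriction (singletons ({1..n} - A))) * D A) =
      (\<Sum>A\<in>Pow {1..n} - {{}}. antipode_sum \<phi> ({1..n} - A) * D A)"
  proof (rule sum.cong)
    fix A assume A: "A \<in> Pow {1..n} - {{}}"
    define B where "B = {1..n} - A"
    have finB: "finite B"
      by (simp add: B_def)
    have "B \<subset> {1..n}"
      using A by (auto simp: B_def)
    then have "card B < n"
      using psubset_card_mono[of "{1..n}" B] by simp
    have "S (restriction (singletons B)) = antipode_sum \<phi> B"
    proof (cases "B = {}")
      case True
      then show ?thesis
        by (simp add: restriction_def antipode_one[OF S] antipode_sum_empty[OF phi])
    next
      case False
      then have "card B \<ge> 1"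
        using finB by (simp add: Suc_le_eq card_gt_0_iff)
      then have "S (J (card B)) = antipode_sum \<phi> {1..card B}"
        using less.IH \<open>card B < n\<close> by blast
      also have "\<dots> = antipode_sum \<phi> B"
        using \<open>card B \<ge> 1\<close> finB False by (simp add: antipode_sum_eq)
      finally show ?thesis
        using False finB by (simp add: restriction_singletons)
    qed
    then show "S (restriction (singletons ({1..n} - A))) * D A = antipode_sum \<phi> ({1..n} - A) * D A"
      by (simp add: B_def)
  qed simp
  also have "\<dots> = - antipode_sum \<phi> {1..n}"
  proof -
    have "0 = antipode_sum \<phi> {1..n} + (\<Sum>A\<in>Pow {1..n} - {{}}. antipode_sum \<phi> ({1..n} - A) * D A)"
      unfolding antipode_sum_recursion[OF phi less.prems, symmetric]
      by (subst sum.remove[of _ "{}"]) (simp_all add: D_def)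
    then show ?thesis
      by (simp add: eq_neg_iff_add_eq_0 add.commute)
  qed
  also have "restriction (singletons {1..n}) = (J n :: 'k ncp_alg)"
    using less.prems by (simp add: restriction_singletons)
  finally show ?case
    by simp
qed

section \<open>Collecting terms by block sizes\<close>

lemma finite_NCP: "n \<ge> 1 \<Longrightarrow> finite (NCP n)"
  using bij_betw_finite[OF bij_betw_blocks] by (simp add: finite_nc_partitions)

lemma finite_Part: "finite (Part n)"
proof (rule finite_subset)
  show "Part n \<subseteq> {1..n} \<rightarrow>\<^sub>E {0..n}"
  proof
    fix k assume k: "k \<in> Part n"
    have "k i \<le> n" if i: "i \<in> {1..n}" for i
    proof -
      have "k i \<le> i * k i"
        using i by simp
      also have "\<dots> \<le> (\<Sum>j=1..n. j * k j)"
        using i by (intro member_le_sum) auto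
      also have "\<dots> = n"
        using k by (simp add: Part_def)
      finally show ?thesis .
    qed
    then show "k \<in> {1..n} \<rightarrow>\<^sub>E {0..n}"
      using k by (auto simp: Part_def PiE_iff)
  qed
qed (simp add: finite_PiE)

context
  fixes \<pi> :: ncp and n :: nat
  assumes \<pi>: "\<pi> \<in> NCP n" and n: "n \<ge> 1"
begin

lemma NCP_nc_partitions: "blocks \<pi> \<in> nc_partitions {1..n}"
  using bij_betw_blocks[OF n] \<pi> by (auto simp: bij_betw_def)

lemma card_block_range: "card ` blocks \<pi> \<subseteq> {1..n}"
proof
  fix i assume "i \<in> card ` blocks \<pi>"
  then obtain b where b: "b \<in> blocks \<pi>" "i = card b"
    by blast
  note P = NCP_nc_partitions
  have "b \<subseteq> {1..n}" "b \<noteq> {}"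
    using nc_partitionsD(1,2)[OF P] b(1) by (blast, metis)
  moreover from this have "finite b"
    by (auto intro: finite_subset)
  ultimately show "i \<in> {1..n}"
    using card_mono[of "{1..n}" b] by (auto simp: b(2) Suc_le_eq card_gt_0_iff)
qed

lemma prod_block_sizes: "(\<Prod>b\<in>blocks \<pi>. f (card b)) = (\<Prod>i=1..n. f i ^ block_sizes n \<pi> i)"
proof -
  have "(\<Prod>b\<in>blocks \<pi>. f (card b)) = (\<Prod>i=1..n. \<Prod>b | b \<in> blocks \<pi> \<and> card b = i. f (card b))"
    using prod.group[OF finite_blocks finite_atLeastAtMost card_block_range, of "\<lambda>b. f (card b)"] by simp
  also have "\<dots> = (\<Prod>i=1..n. f i ^ block_sizes n \<pi> i)"
    by (intro prod.cong refl) (simp add: block_sizes_def)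
  finally show ?thesis .
qed

lemma sum_block_sizes: "(\<Sum>b\<in>blocks \<pi>. f (card b)) = (\<Sum>i=1..n. f i * block_sizes n \<pi> i)"
proof -
  have "(\<Sum>b\<in>blocks \<pi>. f (card b)) = (\<Sum>i=1..n. \<Sum>b | b \<in> blocks \<pi> \<and> card b = i. f (card b))"
    using sum.group[OF finite_blocks finite_atLeastAtMost card_block_range, of "\<lambda>b. f (card b)"] by simp
  also have "\<dots> = (\<Sum>i=1..n. f i * block_sizes n \<pi> i)"
    by (intro sum.cong refl) (simp add: block_sizes_def)
  finally show ?thesis .
qed

lemma block_sizes_in_Part: "block_sizes n \<pi> \<in> Part n"
proof -
  note P = NCP_nc_partitions
  have "n = card (\<Union>(blocks \<pi>))"
    using nc_partitionsD(1)[OF P] by simp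
  also have "\<dots> = (\<Sum>b\<in>blocks \<pi>. card b)"
    using nc_partitionsD(3)[OF P] finite_nc_partition(2)[OF P]
    by (intro card_Union_disjoint) (auto simp: pairwise_def disjnt_def)
  also have "\<dots> = (\<Sum>i=1..n. i * block_sizes n \<pi> i)"
    by (rule sum_block_sizes)
  finally show ?thesis
    unfolding Part_def by (simp add: block_sizes_def)
qed

end

lemma mu_sum_eq:
  fixes \<phi> :: "'k::field_char_0 ncp_alg \<Rightarrow> 'k poly"
  assumes phi: "is_phi \<phi>" and n: "n \<ge> 1"
  shows "(\<Sum>\<pi>\<in>NCP n. scale_alg (mu \<phi> (gen \<pi>)) (\<Prod>b\<in>blocks \<pi>. J (card b))) =
     (\<Sum>k\<in>Part n. scale_alg
        ((- 1) ^ (\<Sum>i=1..n. k i) *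
         (\<Sum>\<pi> | \<pi> \<in> NCP n \<and> block_sizes n \<pi> = k. \<Prod>C\<in>blocks \<pi> // sim \<pi>. cat (card C)))
        (\<Prod>i=1..n. J i ^ k i))"
proof -
  define h where "h = (\<lambda>\<pi>. scale_alg (mu \<phi> (gen \<pi>)) (\<Prod>b\<in>blocks \<pi>. J (card b)))"
  have h: "h \<pi> = scale_alg ((- 1) ^ (\<Sum>i=1..n. k i) * (\<Prod>C\<in>blocks \<pi> // sim \<pi>. cat (card C)))
      (\<Prod>i=1..n. J i ^ k i)" if \<pi>: "\<pi> \<in> NCP n" "block_sizes n \<pi> = k" for \<pi> k
  proof -
    have "card (blocks \<pi>) = (\<Sum>i=1..n. k i)"
      using sum_block_sizes[OF \<pi>(1) n, of "\<lambda>_. 1"] \<pi>(2) by simp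
    then show ?thesis
      unfolding h_def mu_gen[OF phi] prod_block_sizes[OF \<pi>(1) n] chain_weight_def sim_eq_chain_rel
      by (simp add: \<pi>(2))
  qed
  have "(\<Sum>\<pi>\<in>NCP n. h \<pi>) = (\<Sum>k\<in>Part n. \<Sum>\<pi> | \<pi> \<in> NCP n \<and> block_sizes n \<pi> = k. h \<pi>)"
    using block_sizes_in_Part n by (intro sum.group[symmetric] finite_NCP finite_Part) auto
  also have "\<dots> = (\<Sum>k\<in>Part n. scale_alg
        ((- 1) ^ (\<Sum>i=1..n. k i) *
         (\<Sum>\<pi> | \<pi> \<in> NCP n \<and> block_sizes n \<pi> = k. \<Prod>C\<in>blocks \<pi> // sim \<pi>. cat (card C)))
        (\<Prod>i=1..n. J i ^ k i))"
    unfolding sum_distrib_left scale_alg_sum_left by (intro sum.cong refl h) auto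
  finally show ?thesis
    by (simp add: h_def)
qed

lemma discrete_ncp_eq_iff:
  assumes "m \<ge> 1" "n \<ge> 1"
  shows "discrete_ncp m = discrete_ncp n \<longleftrightarrow> m = n"
proof
  assume "discrete_ncp m = discrete_ncp n"
  then have "card (blocks (discrete_ncp m)) = card (blocks (discrete_ncp n))"
    by simp
  then show "m = n"
    using assms by (simp add: blocks_discrete_ncp card_image)
qed simp

lemma prod_J_monomial:
  "(\<Prod>b\<in>P. J (card b)) =
     (Poly_Mapping.single (image_mset (\<lambda>b. discrete_ncp (card b)) (mset_set P)) 1 :: 'k::comm_ring_1 ncp_alg)"
  by (induction P rule: infinite_finite_induct) (simp_all add: J_def gen_def mult_single)

text \<open>Only the discrete partition contributes to the coefficient of \<open>J 1 ^ n\<close>.\<close>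

lemma discrete_monomial_iff:
  assumes \<pi>: "\<pi> \<in> NCP n" and n: "n \<ge> 1"
  shows "image_mset (\<lambda>b. discrete_ncp (card b)) (mset_set (blocks \<pi>)) = replicate_mset n (discrete_ncp 1)
    \<longleftrightarrow> \<pi> = discrete_ncp n"
proof
  assume "\<pi> = discrete_ncp n"
  then have blk: "blocks \<pi> = singletons {1..n}"
    using n by (simp add: blocks_discrete_ncp)
  have "image_mset (\<lambda>b. discrete_ncp (card b)) (mset_set (blocks \<pi>)) =
      image_mset (\<lambda>b. discrete_ncp 1) (mset_set (blocks \<pi>))"
    using finite_blocks by (intro image_mset_cong) (auto simp: blk)
  also have "\<dots> = replicate_mset n (discrete_ncp 1)"
    by (simp add: image_mset_const_eq blk card_image)
  finally show "image_mset (\<lambda>b. discrete_ncp (card b)) (mset_set (blocks \<pi>)) = replicate_mset n (discrete_ncp 1)" .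
next
  assume *: "image_mset (\<lambda>b. discrete_ncp (card b)) (mset_set (blocks \<pi>)) = replicate_mset n (discrete_ncp 1)"
  note P = NCP_nc_partitions[OF \<pi> n]
  have one: "\<exists>x. b = {x}" if b: "b \<in> blocks \<pi>" for b
  proof -
    have "discrete_ncp (card b) \<in># image_mset (\<lambda>b. discrete_ncp (card b)) (mset_set (blocks \<pi>))"
      using b finite_blocks by auto
    then have "discrete_ncp (card b) = discrete_ncp 1"
      unfolding * by (simp split: if_splits)
    moreover have "card b \<ge> 1"
      using card_block_range[OF \<pi> n] b by auto
    ultimately have "card b = 1"
      using discrete_ncp_eq_iff[of "card b" 1] by simp
    then show ?thesis
      by (rule card_1_singletonE) blast
  qed
  have "blocks \<pi> = singletons {1..n}"
  proof
    show "blocks \<pi> \<subseteq> singletons {1..n}"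
    proof
      fix b assume b: "b \<in> blocks \<pi>"
      then obtain x where x: "b = {x}"
        using one by blast
      then have "x \<in> {1..n}"
        using nc_partitionsD(1)[OF P] b by blast
      then show "b \<in> singletons {1..n}"
        using x by simp
    qed
    show "singletons {1..n} \<subseteq> blocks \<pi>"
    proof
      fix b assume "b \<in> singletons {1..n}"
      then obtain x where x: "b = {x}" "x \<in> {1..n}"
        by blast
      then obtain c where c: "c \<in> blocks \<pi>" "x \<in> c"
        using nc_partitionsD(1)[OF P] by blast
      then have "c = {x}"
        using one by blast
      then show "b \<in> blocks \<pi>"
        using c x by simp
    qed
  qed
  then show "\<pi> = discrete_ncp n"
    using n blocks_inject[of \<pi> "discrete_ncp n"] by (simp add: blocks_discrete_ncp)
qed

text \<open>All blocks are outer, so they form a single chain.\<close>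

lemma chain_weight_singletons:
  assumes "n \<ge> 1"
  shows "chain_weight (singletons {1..n}) = (cat n :: 'k::field_char_0)"
proof -
  define Q where "Q = singletons {1..n}"
  have P: "Q \<in> nc_partitions {1..n}"
    by (auto simp: Q_def nc_partitions_def partition_on_def disjoint_def noncrossing_def)
  have "is_interval_nat {1..n}"
    unfolding is_interval_nat_def using assms by blast
  moreover have "outer Q = Q"
    by (auto simp: Q_def outer_def)
  ultimately have QQ: "Q \<in> Q // chain_rel Q"
    using outer_chain_class[OF P] by simp
  have "C = Q" if C: "C \<in> Q // chain_rel Q" for C
  proof -
    note E = equiv_chain_rel[OF P finite_atLeastAtMost]
    have "C \<subseteq> Q" "C \<noteq> {}"
      using in_quotient_imp_subset[OF E C] in_quotient_imp_non_empty[OF E C] by auto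
    then show ?thesis
      using quotient_disj[OF E C QQ] by blast
  qed
  then have "Q // chain_rel Q = {Q}"
    using QQ by blast
  then show ?thesis
    by (simp add: chain_weight_def Q_def[symmetric]) (simp add: Q_def card_image)
qed

theorem proposition3p6:
  fixes S :: "'k::field_char_0 ncp_alg \<Rightarrow> 'k ncp_alg"
    and \<phi> :: "'k ncp_alg \<Rightarrow> 'k poly"
    and n :: nat
  assumes "is_antipode S" and "is_phi \<phi>" and "n \<ge> 1"
  shows
    "S (J n) = (\<Sum>\<pi>\<in>NCP n. scale_alg (mu \<phi> (gen \<pi>)) (\<Prod>b\<in>blocks \<pi>. J (card b))) \<and>
     (\<Sum>\<pi>\<in>NCP n. scale_alg (mu \<phi> (gen \<pi>)) (\<Prod>b\<in>blocks \<pi>. J (card b))) =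
       (\<Sum>k\<in>Part n. scale_alg
          ((- 1) ^ (\<Sum>i=1..n. k i) *
           (\<Sum>\<pi> | \<pi> \<in> NCP n \<and> block_sizes n \<pi> = k. \<Prod>C\<in>blocks \<pi> // sim \<pi>. cat (card C)))
          (\<Prod>i=1..n. J i ^ k i)) \<and>
     Poly_Mapping.lookup (S (J n)) (replicate_mset n (discrete_ncp 1)) = (- 1) ^ n * cat n"
proof (intro conjI)
  show SJ: "S (J n) = (\<Sum>\<pi>\<in>NCP n. scale_alg (mu \<phi> (gen \<pi>)) (\<Prod>b\<in>blocks \<pi>. J (card b)))"
    using antipode_J[OF assms] antipode_sum_eq[of "{1..n}" \<phi>] assms(3) by simp
  show "(\<Sum>\<pi>\<in>NCP n. scale_alg (mu \<phi> (gen \<pi>)) (\<Prod>b\<in>blocks \<pi>. J (card b))) =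
       (\<Sum>k\<in>Part n. scale_alg
          ((- 1) ^ (\<Sum>i=1..n. k i) *
           (\<Sum>\<pi> | \<pi> \<in> NCP n \<and> block_sizes n \<pi> = k. \<Prod>C\<in>blocks \<pi> // sim \<pi>. cat (card C)))
          (\<Prod>i=1..n. J i ^ k i))"
    by (rule mu_sum_eq[OF assms(2,3)])
  have "Poly_Mapping.lookup (S (J n)) (replicate_mset n (discrete_ncp 1)) =
      (\<Sum>\<pi>\<in>NCP n. if \<pi> = discrete_ncp n then mu \<phi> (gen \<pi>) else 0)"
    unfolding SJ lookup_sum
  proof (rule sum.cong)
    fix \<pi> assume "\<pi> \<in> NCP n"
    then show "Poly_Mapping.lookup (scale_alg (mu \<phi> (gen \<pi>)) (\<Prod>b\<in>blocks \<pi>. J (card b)))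
        (replicate_mset n (discrete_ncp 1)) = (if \<pi> = discrete_ncp n then mu \<phi> (gen \<pi>) else 0)"
      using discrete_monomial_iff[of \<pi> n] assms(3)
      by (simp add: prod_J_monomial scale_alg_def mult_single lookup_single when_def)
  qed simp
  also have "\<dots> = mu \<phi> (gen (discrete_ncp n))"
    using finite_NCP assms(3) partition_onI[of "singletons {1..n}" "{1..n}"]
    by (auto simp: NCP_def blocks_discrete_ncp disjnt_def)
  also have "\<dots> = (- 1) ^ n * cat n"
    using assms(3) chain_weight_singletons[OF assms(3), where 'k = 'k]
    by (simp add: mu_gen[OF assms(2)] blocks_discrete_ncp card_image)
  finally show "Poly_Mapping.lookup (S (J n)) (replicate_mset n (discrete_ncp 1)) = (- 1) ^ n * cat n" .
qed

end
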